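(* Let $T_1,T_2$ be two simplicial trees dual to one-edge splittings of a finitely generated group $G$, such that each edge or vertex stabilizer of $T_1$ either acts non-trivially on $T_2$ or has a fixed point in $T_2$. Then Scott and Swarup's (asymmetric) strong intersection number $si(T_1,T_2)$ is the number of two-cells of $\mathcal{A}_1(T_1\times T_2)/G$. This number can also be computed as the number of $G_{e_1}$-orbits of edges in $\mathrm{Min}_{T_2}(G_{e_1})$, where $e_1$ is any edge of $T_1$.
   Context: $G_x$ denotes the stabilizer of a point or edge $x$. A group acts trivially on a tree if all its elements are elliptic (fix a point). If a group $H$ acts non-trivially on $T$, $\mathrm{Min}_T(H)$ is the unique minimal non-empty $H$-invariant subtree, i.e. the union of the axes of hyperbolic elements of $H$. (If $G_{e_1}$ is elliptic in $T_2$, the number of orbits of edges in $\mathrm{Min}_{T_2}(G_{e_1})$ is understood as $0$.) Asymmetric core: if each edge stabilizer of $T_1$ acts non-trivially on $T_2$, then $\mathcal{A}_1(T_1\times T_2)=\bigcup_{x_1\in T_1}\{x_1\}\times\mathrm{Min}_{T_2}(G_{x_1})$ (stabilizers of points in the interior of an edge being the edge stabilizer). More generally, if each edge or vertex stabilizer of $T_1$ acts non-trivially or has a fixed point in $T_2$, one constructs $\mathcal{A}_1$ equivariantly as follows: over a vertex or (open) edge $x_1$ with $G_{x_1}$ acting non-trivially, the fiber of $\mathcal A_1$ is $\{x_1\}\times\mathrm{Min}_{T_2}(G_{x_1})$; over a vertex $x_1$ with $G_{x_1}$ elliptic in $T_2$, the fiber is $\{(x_1,x_2)\}$ for a chosen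 fixed point $x_2$ of $G_{x_1}$; over an edge $e_1$ with endpoints $a_1,b_1$ and $G_{e_1}$ elliptic in $T_2$, the part of $\mathcal A_1$ is a chosen segment joining a fixed point of $G_{e_1}$ in the fiber over $a_1$ to one in the fiber over $b_1$. The $2$-cells of $\mathcal{A}_1$ do not depend on the choices. Strong intersection number: for an oriented edge $e_i$ of $T_i$, let $\delta(e_i)$ be the component of the complement of the origin of $e_i$ containing $e_i$, and $X_{e_i}=\{g\in G\mid g.*_i\in\delta(e_i)\}$, with $*_i\in T_i$ a base point and $X^*=G\setminus X$. For a finite generating set $S$ of $G$ put $\partial X_{e_i}=\{g\in X_{e_i}\mid \exists s\in S\cup S^{-1},\ gs\notin X_{e_i}\}$. One says $X_{e_1}$ crosses strongly $X_{e_2}$ if both $\partial X_{e_1}\cap X_{e_2}$ and $\partial X_{e_1}\cap X_{e_2}^*$ project to infinite sets in $G_{e_2}\backslash G$ (independent of $S$). $si(T_1,T_2)$ is the number of $G$-orbits of pairs of non-oriented edges $(e_1,e_2)$, $e_i$ an edge of $T_i$, such that $X_{e_1}$ crosses strongly $X_{e_2}$. *)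

theory Defs
  imports "HOL-Analysis.Analysis" "HOL-Algebra.Group_Action" "HOL-Algebra.Generated_Groups"
    "HOL-Library.Extended_Nat"
begin

section \<open>Simplicial trees and their points\<close>

text \<open>An edge is the set of its two endpoints; there are no loops and no multiple edges.\<close>

definition walk :: "'v set \<Rightarrow> 'v set set \<Rightarrow> 'v list \<Rightarrow> bool" where
  "walk V E xs \<longleftrightarrow> xs \<noteq> [] \<and> set xs \<subseteq> V \<and> successively (\<lambda>u v. {u, v} \<in> E) xs"

definition simplicial_tree :: "'v set \<Rightarrow> 'v set set \<Rightarrow> bool" where
  "simplicial_tree V E \<longleftrightarrow>
     V \<noteq> {} \<and> (\<forall>e\<in>E. \<exists>u\<in>V. \<exists>v\<in>V. u \<noteq> v \<and> e = {u, v}) \<and>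
     (\<forall>u\<in>V. \<forall>v\<in>V. \<exists>!xs. walk V E xs \<and> distinct xs \<and> hd xs = u \<and> last xs = v)"

text \<open>The points of a tree are given by their barycentric coordinates. The topology used on
  them is the product topology of the function space; on a locally infinite tree it is coarser than
  the metric topology, but the complement of a vertex has the same connected components in both.\<close>

definition supp :: "('v \<Rightarrow> real) \<Rightarrow> 'v set" where
  "supp p = {v. p v \<noteq> 0}"

definition realization :: "'v set \<Rightarrow> 'v set set \<Rightarrow> ('v \<Rightarrow> real) set" where
  "realization V E =
     {p. (\<forall>v. 0 \<le> p v) \<and> ((\<exists>v\<in>V. supp p = {v}) \<or> supp p \<in> E) \<and> (\<Sum>v\<in>supp p. p v) = 1}"

definition vpoint :: "'v \<Rightarrow> 'v \<Rightarrow> real" where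
  "vpoint a = indicator {a}"

definition vdist :: "'v set \<Rightarrow> 'v set set \<Rightarrow> 'v \<Rightarrow> 'v \<Rightarrow> nat" where
  "vdist V E u v = (LEAST n. \<exists>xs. walk V E xs \<and> hd xs = u \<and> last xs = v \<and> length xs = Suc n)"

text \<open>The path metric with edges of length 1: a point \<open>p\<close> is at distance \<open>1 - p u\<close> from
  an endpoint \<open>u\<close> of the edge carrying it, and two points \<open>p\<close>, \<open>q\<close> of the same closed edge
  with endpoint \<open>u\<close> are at distance \<open>\<bar>p u - q u\<bar>\<close>.\<close>

definition tdist :: "'v set \<Rightarrow> 'v set set \<Rightarrow> ('v \<Rightarrow> real) \<Rightarrow> ('v \<Rightarrow> real) \<Rightarrow> real" where
  "tdist V E p q =
     (if \<exists>e\<in>E. supp p \<union> supp q \<subseteq> e then (\<Sum>v\<in>supp p \<union> supp q. \<bar>p v - q v\<bar>) / 2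
      else Min {(1 - p u) + real (vdist V E u w) + (1 - q w) | u w. u \<in> supp p \<and> w \<in> supp q})"

section \<open>Groups acting on trees\<close>

record ('a, 'v) gtree =
  verts :: "'v set"
  edges :: "'v set set"
  act :: "'a \<Rightarrow> 'v \<Rightarrow> 'v"

definition points :: "('a, 'v) gtree \<Rightarrow> ('v \<Rightarrow> real) set" where
  "points T = realization (verts T) (edges T)"

definition open_edge :: "('a, 'v) gtree \<Rightarrow> 'v set \<Rightarrow> ('v \<Rightarrow> real) set" where
  "open_edge T e = {p \<in> points T. supp p = e}"

definition edge_act :: "('a, 'v) gtree \<Rightarrow> 'a \<Rightarrow> 'v set \<Rightarrow> 'v set" where
  "edge_act T g e = act T g ` e"

definition pt_act :: "('a, 'b) monoid_scheme \<Rightarrow> ('a, 'v) gtree \<Rightarrow> 'a \<Rightarrow> ('v \<Rightarrow> real) \<Rightarrow> 'v \<Rightarrow> real" where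
  "pt_act G T g p = (\<lambda>v. if v \<in> verts T then p (act T (inv\<^bsub>G\<^esub> g) v) else 0)"

text \<open>The Bass-Serre tree of a non-trivial splitting of \<open>G\<close> with one edge: one orbit of edges, no
  inversions, no global fixed point (equivalently, the action is minimal).\<close>

definition one_edge_splitting_tree :: "('a, 'b) monoid_scheme \<Rightarrow> ('a, 'v) gtree \<Rightarrow> bool" where
  "one_edge_splitting_tree G T \<longleftrightarrow>
     group_action G (verts T) (act T) \<and>
     simplicial_tree (verts T) (edges T) \<and>
     (\<forall>g\<in>carrier G. \<forall>e\<in>edges T. edge_act T g e \<in> edges T) \<and>
     (\<forall>g\<in>carrier G. \<forall>u v. {u, v} \<in> edges T \<longrightarrow> \<not> (act T g u = v \<and> act T g v = u)) \<and>
     edges T \<noteq> {} \<and>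
     (\<forall>e\<in>edges T. \<forall>e'\<in>edges T. \<exists>g\<in>carrier G. edge_act T g e = e') \<and>
     \<not> (\<exists>p\<in>points T. \<forall>g\<in>carrier G. pt_act G T g p = p)"

abbreviation vertex_stab :: "('a, 'b) monoid_scheme \<Rightarrow> ('a, 'v) gtree \<Rightarrow> 'v \<Rightarrow> 'a set" where
  "vertex_stab G T v \<equiv> stabilizer G (act T) v"

abbreviation edge_stab :: "('a, 'b) monoid_scheme \<Rightarrow> ('a, 'v) gtree \<Rightarrow> 'v set \<Rightarrow> 'a set" where
  "edge_stab G T e \<equiv> stabilizer G (edge_act T) e"

definition elliptic :: "('a, 'b) monoid_scheme \<Rightarrow> ('a, 'v) gtree \<Rightarrow> 'a \<Rightarrow> bool" where
  "elliptic G T g \<longleftrightarrow> (\<exists>p\<in>points T. pt_act G T g p = p)"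

definition acts_nontrivially :: "('a, 'b) monoid_scheme \<Rightarrow> ('a, 'v) gtree \<Rightarrow> 'a set \<Rightarrow> bool" where
  "acts_nontrivially G T H \<longleftrightarrow> (\<exists>h\<in>H. \<not> elliptic G T h)"

definition fixed_by :: "('a, 'b) monoid_scheme \<Rightarrow> ('a, 'v) gtree \<Rightarrow> 'a set \<Rightarrow> ('v \<Rightarrow> real) \<Rightarrow> bool" where
  "fixed_by G T H p \<longleftrightarrow> p \<in> points T \<and> (\<forall>h\<in>H. pt_act G T h p = p)"

definition has_fixed_point :: "('a, 'b) monoid_scheme \<Rightarrow> ('a, 'v) gtree \<Rightarrow> 'a set \<Rightarrow> bool" where
  "has_fixed_point G T H \<longleftrightarrow> (\<exists>p. fixed_by G T H p)"

text \<open>A subtree is a subcomplex that is a tree; it is given by its vertex set, and contains every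
  edge of the ambient tree whose endpoints it contains.\<close>

definition sub_edges :: "('a, 'v) gtree \<Rightarrow> 'v set \<Rightarrow> 'v set set" where
  "sub_edges T W = {e \<in> edges T. e \<subseteq> W}"

definition invariant_subtree :: "('a, 'v) gtree \<Rightarrow> 'a set \<Rightarrow> 'v set \<Rightarrow> bool" where
  "invariant_subtree T H W \<longleftrightarrow>
     W \<subseteq> verts T \<and> simplicial_tree W (sub_edges T W) \<and> (\<forall>h\<in>H. act T h ` W = W)"

text \<open>Only meaningful when \<open>H\<close> acts non-trivially.\<close>

definition Min_tree :: "('a, 'v) gtree \<Rightarrow> 'a set \<Rightarrow> 'v set" where
  "Min_tree T H = (THE W. invariant_subtree T H W \<and>
     (\<forall>W'. invariant_subtree T H W' \<and> W' \<subseteq> W \<longrightarrow> W' = W))"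

definition Min_points :: "('a, 'v) gtree \<Rightarrow> 'a set \<Rightarrow> ('v \<Rightarrow> real) set" where
  "Min_points T H = realization (Min_tree T H) (sub_edges T (Min_tree T H))"

definition Min_edges :: "('a, 'b) monoid_scheme \<Rightarrow> ('a, 'v) gtree \<Rightarrow> 'a set \<Rightarrow> 'v set set" where
  "Min_edges G T H = (if acts_nontrivially G T H then sub_edges T (Min_tree T H) else {})"

section \<open>The asymmetric core\<close>

definition prod_segment ::
  "('a, 'v) gtree \<Rightarrow> ('a, 'w) gtree \<Rightarrow> ('v \<Rightarrow> real) \<times> ('w \<Rightarrow> real) \<Rightarrow> ('v \<Rightarrow> real) \<times> ('w \<Rightarrow> real)
     \<Rightarrow> (('v \<Rightarrow> real) \<times> ('w \<Rightarrow> real)) set" where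
  \<comment> \<open>the geodesic joining two points of the product, both coordinates having constant speed\<close>
  "prod_segment T1 T2 = (\<lambda>(x, y) (x', y').
     let d1 = tdist (verts T1) (edges T1); d2 = tdist (verts T2) (edges T2) in
     {(z, w). z \<in> points T1 \<and> w \<in> points T2 \<and> (\<exists>t\<in>{0..1}.
        d1 x z = t * d1 x x' \<and> d1 z x' = (1 - t) * d1 x x' \<and>
        d2 y w = t * d2 y y' \<and> d2 w y' = (1 - t) * d2 y y')})"

text \<open>The core depends on choices: \<open>c v\<close> is the fixed point chosen for an elliptic vertex group
  \<open>G\<^sub>v\<close>, and \<open>f e a\<close> is the fixed point of an elliptic edge group \<open>G\<^sub>e\<close> chosen in
  the fiber over the endpoint \<open>a\<close> of \<open>e\<close>.\<close>

definition vertex_fiber ::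
  "('a, 'b) monoid_scheme \<Rightarrow> ('a, 'v) gtree \<Rightarrow> ('a, 'w) gtree \<Rightarrow> ('v \<Rightarrow> 'w \<Rightarrow> real) \<Rightarrow> 'v
     \<Rightarrow> ('w \<Rightarrow> real) set" where
  "vertex_fiber G T1 T2 c v =
     (if acts_nontrivially G T2 (vertex_stab G T1 v) then Min_points T2 (vertex_stab G T1 v)
      else {c v})"

definition core_choices ::
  "('a, 'b) monoid_scheme \<Rightarrow> ('a, 'v) gtree \<Rightarrow> ('a, 'w) gtree
     \<Rightarrow> ('v \<Rightarrow> 'w \<Rightarrow> real) \<Rightarrow> ('v set \<Rightarrow> 'v \<Rightarrow> 'w \<Rightarrow> real) \<Rightarrow> bool" where
  "core_choices G T1 T2 c f \<longleftrightarrow>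
     (\<forall>v\<in>verts T1. has_fixed_point G T2 (vertex_stab G T1 v) \<longrightarrow>
        fixed_by G T2 (vertex_stab G T1 v) (c v) \<and>
        (\<forall>g\<in>carrier G. c (act T1 g v) = pt_act G T2 g (c v))) \<and>
     (\<forall>e\<in>edges T1. \<forall>a\<in>e. has_fixed_point G T2 (edge_stab G T1 e) \<longrightarrow>
        fixed_by G T2 (edge_stab G T1 e) (f e a) \<and> f e a \<in> vertex_fiber G T1 T2 c a \<and>
        (\<forall>g\<in>carrier G. f (edge_act T1 g e) (act T1 g a) = pt_act G T2 g (f e a)))"

definition asymmetric_core ::
  "('a, 'b) monoid_scheme \<Rightarrow> ('a, 'v) gtree \<Rightarrow> ('a, 'w) gtree
     \<Rightarrow> ('v \<Rightarrow> 'w \<Rightarrow> real) \<Rightarrow> ('v set \<Rightarrow> 'v \<Rightarrow> 'w \<Rightarrow> real)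
     \<Rightarrow> (('v \<Rightarrow> real) \<times> ('w \<Rightarrow> real)) set" where
  "asymmetric_core G T1 T2 c f =
     (\<Union>v\<in>verts T1. {vpoint v} \<times> vertex_fiber G T1 T2 c v) \<union>
     (\<Union>e\<in>{e \<in> edges T1. acts_nontrivially G T2 (edge_stab G T1 e)}.
        open_edge T1 e \<times> Min_points T2 (edge_stab G T1 e)) \<union>
     \<Union>{prod_segment T1 T2 (vpoint a, f {a, b} a) (vpoint b, f {a, b} b) | a b.
        {a, b} \<in> edges T1 \<and> has_fixed_point G T2 (edge_stab G T1 {a, b})}"

definition two_cells ::
  "('a, 'v) gtree \<Rightarrow> ('a, 'w) gtree \<Rightarrow> (('v \<Rightarrow> real) \<times> ('w \<Rightarrow> real)) set \<Rightarrow> ('v set \<times> 'w set) set" where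
  "two_cells T1 T2 A =
     {(e1, e2). e1 \<in> edges T1 \<and> e2 \<in> edges T2 \<and> open_edge T1 e1 \<times> open_edge T2 e2 \<subseteq> A}"

definition edge_pair_act ::
  "('a, 'v) gtree \<Rightarrow> ('a, 'w) gtree \<Rightarrow> 'a \<Rightarrow> 'v set \<times> 'w set \<Rightarrow> 'v set \<times> 'w set" where
  "edge_pair_act T1 T2 g = map_prod (edge_act T1 g) (edge_act T2 g)"

definition ecard :: "'x set \<Rightarrow> enat" where
  "ecard X = (if finite X then enat (card X) else \<infinity>)"

section \<open>The strong intersection number\<close>

text \<open>An oriented edge is a pair \<open>(a, b)\<close> with origin \<open>a\<close>.\<close>

definition half_tree :: "('a, 'v) gtree \<Rightarrow> 'v \<times> 'v \<Rightarrow> ('v \<Rightarrow> real) set" where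
  "half_tree T = (\<lambda>(a, b). \<Union>{C \<in> components (points T - {vpoint a}). open_edge T {a, b} \<subseteq> C})"

definition half_set ::
  "('a, 'b) monoid_scheme \<Rightarrow> ('a, 'v) gtree \<Rightarrow> ('v \<Rightarrow> real) \<Rightarrow> 'v \<times> 'v \<Rightarrow> 'a set" where
  "half_set G T p e = {g \<in> carrier G. pt_act G T g p \<in> half_tree T e}"

definition cayley_boundary :: "('a, 'b) monoid_scheme \<Rightarrow> 'a set \<Rightarrow> 'a set \<Rightarrow> 'a set" where
  "cayley_boundary G S X = {g \<in> X. \<exists>s \<in> S \<union> m_inv G ` S. g \<otimes>\<^bsub>G\<^esub> s \<notin> X}"

text \<open>\<open>H\<close> is the stabilizer of the edge defining \<open>Y\<close>.\<close>

definition crosses_strongly ::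
  "('a, 'b) monoid_scheme \<Rightarrow> 'a set \<Rightarrow> 'a set \<Rightarrow> 'a set \<Rightarrow> 'a set \<Rightarrow> bool" where
  "crosses_strongly G S X H Y \<longleftrightarrow>
     infinite ((\<lambda>g. H #>\<^bsub>G\<^esub> g) ` (cayley_boundary G S X \<inter> Y)) \<and>
     infinite ((\<lambda>g. H #>\<^bsub>G\<^esub> g) ` (cayley_boundary G S X \<inter> (carrier G - Y)))"

text \<open>Strong crossing does not depend on the orientations chosen on the two edges.\<close>

definition strongly_crossing_pairs ::
  "('a, 'b) monoid_scheme \<Rightarrow> 'a set \<Rightarrow> ('a, 'v) gtree \<Rightarrow> ('v \<Rightarrow> real) \<Rightarrow> ('a, 'w) gtree \<Rightarrow> ('w \<Rightarrow> real)
     \<Rightarrow> ('v set \<times> 'w set) set" where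
  "strongly_crossing_pairs G S T1 p1 T2 p2 =
     {({a, b}, {c, d}) | a b c d. {a, b} \<in> edges T1 \<and> {c, d} \<in> edges T2 \<and>
        crosses_strongly G S (half_set G T1 p1 (a, b))
          (edge_stab G T2 {c, d}) (half_set G T2 p2 (c, d))}"

definition strong_intersection_number ::
  "('a, 'b) monoid_scheme \<Rightarrow> 'a set \<Rightarrow> ('a, 'v) gtree \<Rightarrow> ('v \<Rightarrow> real) \<Rightarrow> ('a, 'w) gtree \<Rightarrow> ('w \<Rightarrow> real)
     \<Rightarrow> enat" where
  "strong_intersection_number G S T1 p1 T2 p2 =
     ecard (orbits G (strongly_crossing_pairs G S T1 p1 T2 p2) (edge_pair_act T1 T2))"

end

theory Submission
  imports Defs
begin

text \<open>The three numbers count orbits of the same set of pairs of edges, namely the pairs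
  \<open>(e\<^sub>1, e\<^sub>2)\<close> such that \<open>e\<^sub>2\<close> lies in the minimal
  subtree of \<open>T\<^sub>2\<close> for the stabilizer \<open>K\<close> of
  \<open>e\<^sub>1\<close> (there is no such \<open>e\<^sub>2\<close> if \<open>K\<close> is
  elliptic).

  \<^item> Two-cells (\<open>two_cells_core\<close>). Over an open edge \<open>e\<^sub>1\<close> whose
  stabilizer acts non-trivially the core is a product with the minimal subtree by construction. If
  \<open>K\<close> has a fixed point, then the core over the midpoint of \<open>e\<^sub>1\<close>
  consists of points at a prescribed distance from one of two given points of
  \<open>T\<^sub>2\<close>; these are finitely many on each edge, so they do not fill an open edge.

  \<^item> Strong crossing (\<open>crosses_strongly_iff\<close>). An element \<open>g\<close> of the
  boundary of the half set of \<open>e\<^sub>1\<close> has a neighbour \<open>g s\<close> in the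
  Cayley graph such that \<open>g\<close> and \<open>g s\<close> move the base point to different
  sides of \<open>e\<^sub>1\<close>. Then \<open>g\<^sup>-\<^sup>1 e\<^sub>1\<close> separates the
  base point from its image under the generator \<open>s\<close>, so only finitely many edges
  \<open>g\<^sup>-\<^sup>1 e\<^sub>1\<close> occur: the boundary is a finite union of cosets
  \<open>K f\<close>. A coset \<open>G\<^sub>e\<^sub>2 g\<close>, with
  \<open>G\<^sub>e\<^sub>2\<close> the stabilizer of \<open>e\<^sub>2\<close>, is in the same way
  the edge \<open>g\<^sup>-\<^sup>1 e\<^sub>2\<close>. If \<open>K\<close> preserves a subtree
  \<open>W\<close> that misses \<open>e\<^sub>2\<close>, take a point \<open>w\<close> of
  \<open>W\<close>: an element \<open>g = h f\<close> with \<open>h\<close> in \<open>K\<close> that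
  moves the base point to the side of \<open>e\<^sub>2\<close> opposite to \<open>W\<close> has
  \<open>h\<^sup>-\<^sup>1 e\<^sub>2\<close> among the finitely many edges between \<open>w\<close>
  and \<open>f\<close> times the base point, and there is no crossing. If \<open>e\<^sub>2\<close>
  is in the minimal subtree, then it lies on the axis of some \<open>h\<close> in \<open>K\<close>,
  and the elements \<open>h\<^sup>n f\<close> with \<open>n\<close> large, positive or negative,
  give infinitely many cosets on both sides. A boundary element \<open>f\<close> exists because
  every side of every edge contains translates of the base point (\<open>second_neighbour\<close>).

  \<^item> The orbits of \<open>G\<close> on the pairs are the orbits of \<open>K\<close> on the
  second components over a fixed \<open>e\<^sub>1\<close>, since \<open>T\<^sub>1\<close> has one
  orbit of edges (\<open>ecard_orbits_fiber\<close>).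

  The theory of axes is developed without the metric. An edge \<open>{a, b}\<close> is on an axis of
  \<open>H\<close> if some element of \<open>H\<close> moves one of its two sides properly into
  itself. The edges of this kind span the least \<open>H\<close>-invariant subtree as soon as
  \<open>H\<close> contains an element without fixed point (\<open>Min_tree_eq\<close>): they are
  contained in every invariant subtree because powers of the shifting element move each vertex to
  both sides of the edge; they exist because an element without fixed point shifts the first edge of
  a shortest arc from a vertex to its image; and they are connected by a ping-pong argument
  (\<open>axis_edges_between\<close>).\<close>

section \<open>Sides of an edge in a tree\<close>

definition adjacency :: "'v set set \<Rightarrow> ('v \<times> 'v) set" where
  "adjacency E = {(u, v). {u, v} \<in> E}"

text \<open>The far side of the oriented edge \<open>(a, b)\<close>. Defining it by reachability after deletion
  of the edge, not by arcs through the edge, makes equivariance and nestedness of sides inductions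
  along a chain of edges.\<close>

definition side :: "'v set set \<Rightarrow> 'v \<Rightarrow> 'v \<Rightarrow> 'v set" where
  "side E a b = {x. (b, x) \<in> (adjacency (E - {{a, b}}))\<^sup>*}"

definition separating :: "'v set set \<Rightarrow> 'v \<Rightarrow> 'v \<Rightarrow> 'v set set" where
  "separating E u v = {{a, b} | a b. {a, b} \<in> E \<and> u \<notin> side E a b \<and> v \<in> side E a b}"

lemma adjacency_sym: "(u, v) \<in> (adjacency E)\<^sup>* \<Longrightarrow> (v, u) \<in> (adjacency E)\<^sup>*"
proof -
  have "sym (adjacency E)"
    by (auto simp: adjacency_def sym_def insert_commute)
  then show "(u, v) \<in> (adjacency E)\<^sup>* \<Longrightarrow> (v, u) \<in> (adjacency E)\<^sup>*"
    by (meson sym_rtrancl symD)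
qed

lemma successively_linked:
  assumes "successively (\<lambda>u v. {u, v} \<in> E) xs" "xs \<noteq> []"
  shows "(hd xs, last xs) \<in> (adjacency E)\<^sup>*"
  using assms
proof (induction xs rule: induct_list012)
  case (3 x y zs)
  then have "(x, y) \<in> adjacency E" "(y, last (y # zs)) \<in> (adjacency E)\<^sup>*"
    by (auto simp: adjacency_def)
  then show ?case
    by (simp add: converse_rtrancl_into_rtrancl)
qed auto

lemma linked_imp_path:
  assumes "(u, v) \<in> (adjacency E)\<^sup>*" "u \<in> V" "\<And>e. e \<in> E \<Longrightarrow> e \<subseteq> V"
  shows "\<exists>xs. walk V E xs \<and> distinct xs \<and> hd xs = u \<and> last xs = v"
  using assms(1)
proof (induction rule: rtrancl_induct)
  case base
  show ?case
    using assms(2) by (intro exI[of _ "[u]"]) (simp add: walk_def)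
next
  case (step y z)
  then obtain xs where xs: "walk V E xs" "distinct xs" "hd xs = u" "last xs = y"
    by blast
  have yz: "{y, z} \<in> E"
    using step by (simp add: adjacency_def)
  show ?case
  proof (cases "z \<in> set xs")
    case True
    then obtain ys zs where "xs = ys @ z # zs"
      by (meson split_list)
    then show ?thesis
      using xs
      by (intro exI[of _ "ys @ [z]"])
        (auto simp: walk_def successively_append_iff hd_append split: if_splits)
  next
    case False
    then show ?thesis
      using xs yz assms(3)[OF yz]
      by (intro exI[of _ "xs @ [z]"]) (auto simp: walk_def successively_append_iff)
  qed
qed

lemma side_self: "b \<in> side E a b"
  by (simp add: side_def)

lemma side_edge:
  assumes "{x, y} \<in> E" "{x, y} \<noteq> {a, b}"
  shows "x \<in> side E a b \<longleftrightarrow> y \<in> side E a b"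
proof -
  have "(x, y) \<in> adjacency (E - {{a, b}})" "(y, x) \<in> adjacency (E - {{a, b}})"
    using assms by (auto simp: adjacency_def insert_commute)
  then show ?thesis
    unfolding side_def by (auto intro: rtrancl_into_rtrancl)
qed

lemma crossing_successively:
  assumes "successively (\<lambda>u v. {u, v} \<in> E) xs" "xs \<noteq> []"
    and "(hd xs \<in> side E a b) \<noteq> (last xs \<in> side E a b)"
  shows "{a, b} \<subseteq> set xs"
  using assms
proof (induction xs rule: induct_list012)
  case (3 x y zs)
  show ?case
  proof (cases "{x, y} = {a, b}")
    case False
    then have "x \<in> side E a b \<longleftrightarrow> y \<in> side E a b"
      using 3 by (intro side_edge) auto
    with 3 show ?thesis
      by auto
  qed auto
qed auto

locale tree =
  fixes V :: "'v set" and E :: "'v set set"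
  assumes is_tree: "simplicial_tree V E"
begin

lemma nonempty: "V \<noteq> {}"
  using is_tree by (simp add: simplicial_tree_def)

lemma edgeE:
  assumes "e \<in> E"
  obtains u v where "u \<in> V" "v \<in> V" "u \<noteq> v" "e = {u, v}"
proof -
  have "\<forall>e\<in>E. \<exists>u\<in>V. \<exists>v\<in>V. u \<noteq> v \<and> e = {u, v}"
    using is_tree by (simp add: simplicial_tree_def)
  then show thesis
    using assms that by metis
qed

lemma edge_subset: "e \<in> E \<Longrightarrow> e \<subseteq> V"
  by (metis edgeE empty_subsetI insert_subset)

lemma edgeD:
  assumes "{a, b} \<in> E"
  shows "a \<in> V" "b \<in> V" "a \<noteq> b"
proof -
  obtain u v where "u \<in> V" "v \<in> V" "u \<noteq> v" "{a, b} = {u, v}"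
    using assms by (rule edgeE)
  then show "a \<in> V" "b \<in> V" "a \<noteq> b"
    by (auto simp: doubleton_eq_iff)
qed

lemma path_exists:
  assumes "u \<in> V" "v \<in> V"
  obtains xs where "walk V E xs" "distinct xs" "hd xs = u" "last xs = v"
proof -
  have "\<exists>!xs. walk V E xs \<and> distinct xs \<and> hd xs = u \<and> last xs = v"
    using is_tree assms by (simp add: simplicial_tree_def)
  then show thesis
    using that by blast
qed

lemma path_unique:
  assumes "walk V E xs" "distinct xs" "walk V E ys" "distinct ys"
    and "hd xs = hd ys" "last xs = last ys"
  shows "xs = ys"
proof -
  have "hd xs \<in> V" "last xs \<in> V"
    using assms(1) by (auto simp: walk_def)
  then have "\<exists>!zs. walk V E zs \<and> distinct zs \<and> hd zs = hd xs \<and> last zs = last xs"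
    using is_tree by (simp add: simplicial_tree_def)
  then show ?thesis
    using assms by metis
qed

lemma connected: "u \<in> V \<Longrightarrow> v \<in> V \<Longrightarrow> (u, v) \<in> (adjacency E)\<^sup>*"
  using path_exists[of u v] successively_linked[of E] unfolding walk_def by metis

lemma side_subset: "{a, b} \<in> E \<Longrightarrow> side E a b \<subseteq> V"
proof
  fix x assume e: "{a, b} \<in> E" and "x \<in> side E a b"
  then have "(b, x) \<in> (adjacency (E - {{a, b}}))\<^sup>*"
    by (simp add: side_def)
  then show "x \<in> V"
  proof (induction rule: rtrancl_induct)
    case base
    show ?case
      using edgeD(2)[OF e] .
  next
    case (step y z)
    then have "{y, z} \<in> E"
      by (simp add: adjacency_def)
    then show ?case
      by (rule edgeD(2))
  qed
qed

text \<open>An arc from \<open>b\<close> to \<open>a\<close> that avoids the edge would be a second arc besides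
  \<open>[b, a]\<close>.\<close>

lemma origin_notin_side:
  assumes "{a, b} \<in> E"
  shows "a \<notin> side E a b"
proof
  assume "a \<in> side E a b"
  then obtain xs where xs: "walk V (E - {{a, b}}) xs" "distinct xs" "hd xs = b" "last xs = a"
    using linked_imp_path[of b a "E - {{a, b}}" V] edgeD[OF assms] edge_subset
    by (auto simp: side_def)
  have "walk V E xs"
    using xs(1) by (auto simp: walk_def elim: successively_mono)
  moreover have "walk V E [b, a]"
    using assms edgeD[OF assms] by (simp add: walk_def insert_commute)
  ultimately have "xs = [b, a]"
    using xs edgeD[OF assms] by (intro path_unique) auto
  with xs(1) show False
    by (simp add: walk_def insert_commute)
qed

lemma mem_side_flip:
  assumes "{a, b} \<in> E" "x \<in> V"
  shows "x \<in> side E b a \<longleftrightarrow> x \<notin> side E a b"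
proof
  assume "x \<in> side E b a"
  then have ax: "(a, x) \<in> (adjacency (E - {{a, b}}))\<^sup>*"
    by (simp add: side_def insert_commute)
  show "x \<notin> side E a b"
  proof
    assume "x \<in> side E a b"
    then have "(b, a) \<in> (adjacency (E - {{a, b}}))\<^sup>*"
      using adjacency_sym[OF ax] by (auto simp: side_def)
    then show False
      using origin_notin_side[OF assms(1)] by (simp add: side_def)
  qed
next
  have "(b, x) \<in> (adjacency E)\<^sup>*"
    using assms edgeD connected by blast
  then have "x \<in> side E a b \<or> x \<in> side E b a"
  proof (induction rule: rtrancl_induct)
    case base
    show ?case
      by (simp add: side_self)
  next
    case (step y z)
    then show ?case
      using side_edge[of y z E a b] side_edge[of y z E b a] side_self[of a E b] side_self[of b E a]
      by (auto simp: adjacency_def doubleton_eq_iff)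
  qed
  then show "x \<notin> side E a b \<Longrightarrow> x \<in> side E b a"
    by blast
qed

lemma side_flip: "{a, b} \<in> E \<Longrightarrow> side E b a = V - side E a b"
  using mem_side_flip side_subset[of b a] by (auto simp: insert_commute)

lemma edge_crossing:
  assumes "{x, y} \<in> E" "x \<in> side E a b" "y \<notin> side E a b" "{a, b} \<in> E"
  shows "x = b" "y = a"
proof -
  have "{x, y} = {a, b}"
    using side_edge[OF assms(1), of a b] assms(2,3) by argo
  then show "x = b" "y = a"
    using assms origin_notin_side[OF assms(4)] by (auto simp: doubleton_eq_iff)
qed

text \<open>Deleting \<open>{c, d}\<close> does not disconnect the side of another edge that does not contain
  \<open>c\<close>.\<close>

lemma side_nested:
  assumes "{a, b} \<in> E" "{a, b} \<noteq> {c, d}" "{c, d} \<in> E" "c \<notin> side E a b" "b \<in> side E c d"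
  shows "side E a b \<subseteq> side E c d"
proof
  fix x assume "x \<in> side E a b"
  then have "(b, x) \<in> (adjacency (E - {{a, b}}))\<^sup>*"
    by (simp add: side_def)
  then have "x \<in> side E a b \<and> x \<in> side E c d"
  proof (induction rule: rtrancl_induct)
    case base
    show ?case
      using assms by (simp add: side_self)
  next
    case (step y z)
    then have yz: "{y, z} \<in> E" "{y, z} \<noteq> {a, b}"
      by (auto simp: adjacency_def)
    then have z: "z \<in> side E a b"
      using side_edge step by metis
    have "{y, z} \<noteq> {c, d}"
      using step z assms(4) by (auto simp: doubleton_eq_iff)
    then show ?case
      using z side_edge yz step by metis
  qed
  then show "x \<in> side E c d"
    by blast
qed

lemma finite_separating:
  assumes "u \<in> V" "v \<in> V"
  shows "finite (separating E u v)"
proof -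
  obtain xs where xs: "walk V E xs" "distinct xs" "hd xs = u" "last xs = v"
    using assms by (rule path_exists)
  have "separating E u v \<subseteq> Pow (set xs)"
    using crossing_successively[of E xs] xs by (fastforce simp: separating_def walk_def)
  then show ?thesis
    by (rule finite_subset) simp
qed

lemma path_edges_separate:
  assumes "walk V E (xs @ x # y # zs)" "distinct (xs @ x # y # zs)"
  shows "hd (xs @ [x]) \<notin> side E x y" "last (y # zs) \<in> side E x y"
proof -
  have xy: "{x, y} \<in> E"
    using assms by (auto simp: walk_def successively_append_iff)
  show "last (y # zs) \<in> side E x y"
  proof (rule ccontr)
    assume "last (y # zs) \<notin> side E x y"
    then have "{x, y} \<subseteq> set (y # zs)"
      using assms side_self[of y E x]
      by (intro crossing_successively[of E]) (auto simp: walk_def successively_append_iff)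
    then show False
      using assms by auto
  qed
  show "hd (xs @ [x]) \<notin> side E x y"
  proof
    assume "hd (xs @ [x]) \<in> side E x y"
    then have "{x, y} \<subseteq> set (xs @ [x])"
      using assms origin_notin_side[OF xy]
      by (intro crossing_successively[of E]) (auto simp: walk_def successively_append_iff)
    then show False
      using assms by auto
  qed
qed

text \<open>Every edge of an arc separates its ends, and every walk uses all edges that separate its ends. So
  among the nonempty sets of vertices the subtrees are those that contain every edge separating two
  of their members.\<close>

lemma subtree_imp_separating:
  assumes "simplicial_tree W F" "F \<subseteq> E" "u \<in> W" "v \<in> W" "e \<in> separating E u v"
  shows "e \<subseteq> W"
proof -
  interpret sub: tree W F
    by standard fact
  obtain xs where xs: "walk W F xs" "distinct xs" "hd xs = u" "last xs = v"
    using assms(3,4) by (rule sub.path_exists)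
  have "successively (\<lambda>u v. {u, v} \<in> E) xs"
    using xs assms(2) by (auto simp: walk_def elim: successively_mono)
  then have "e \<subseteq> set xs"
    using crossing_successively[of E xs] xs assms(5) by (fastforce simp: separating_def walk_def)
  then show ?thesis
    using xs by (auto simp: walk_def)
qed

lemma separating_imp_subtree:
  assumes "W \<subseteq> V" "W \<noteq> {}"
    and sep: "\<And>u v e. u \<in> W \<Longrightarrow> v \<in> W \<Longrightarrow> e \<in> separating E u v \<Longrightarrow> e \<subseteq> W"
  shows "simplicial_tree W {e \<in> E. e \<subseteq> W}"
proof -
  let ?F = "{e \<in> E. e \<subseteq> W}"
  have sub_walk: "walk V E xs" if "walk W ?F xs" for xs
    using that assms(1) by (auto simp: walk_def elim: successively_mono)
  have ex: "\<exists>xs. walk W ?F xs \<and> distinct xs \<and> hd xs = u \<and> last xs = v"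
    if uv: "u \<in> W" "v \<in> W" for u v
  proof -
    obtain xs where xs: "walk V E xs" "distinct xs" "hd xs = u" "last xs = v"
      using assms(1) uv by (meson path_exists subsetD)
    have step: "{x, y} \<in> ?F" if split: "xs = ys @ x # y # zs" for ys x y zs
    proof -
      have "{x, y} \<in> E"
        using xs split by (auto simp: walk_def successively_append_iff)
      moreover have "u \<notin> side E x y" "v \<in> side E x y"
        using path_edges_separate[of ys x y zs] xs split by (auto simp: hd_append split: if_splits)
      ultimately show ?thesis
        using sep[OF uv, of "{x, y}"] by (auto simp: separating_def)
    qed
    have "successively (\<lambda>u v. {u, v} \<in> ?F) (x # zs) \<and> set (x # zs) \<subseteq> W"
      if "xs = ys @ x # zs" "x \<in> W" for ys x zs
      using that
    proof (induction zs arbitrary: ys x)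
      case (Cons z zs)
      have "{x, z} \<in> ?F"
        using Cons.prems by (intro step)
      then show ?case
        using Cons.IH[of "ys @ [x]" z] Cons.prems by auto
    qed auto
    from this[of "[]" u "tl xs"] have "walk W ?F xs"
      using xs uv by (cases xs) (auto simp: walk_def)
    with xs show ?thesis
      by blast
  qed
  have uniq: "xs = ys"
    if "walk W ?F xs \<and> distinct xs \<and> hd xs = u \<and> last xs = v"
      "walk W ?F ys \<and> distinct ys \<and> hd ys = u \<and> last ys = v" for xs ys u v
    using that sub_walk by (intro path_unique) auto
  have ends: "\<exists>u\<in>W. \<exists>v\<in>W. u \<noteq> v \<and> e = {u, v}" if "e \<in> ?F" for e
    using that by (auto elim!: edgeE)
  show ?thesis
    unfolding simplicial_tree_def
  proof (intro conjI ballI)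
    fix u v assume "u \<in> W" "v \<in> W"
    from ex[OF this] obtain xs where "walk W ?F xs \<and> distinct xs \<and> hd xs = u \<and> last xs = v" ..
    then show "\<exists>!xs. walk W ?F xs \<and> distinct xs \<and> hd xs = u \<and> last xs = v"
    proof (rule ex1I)
      fix ys assume "walk W ?F ys \<and> distinct ys \<and> hd ys = u \<and> last ys = v"
      then show "ys = xs"
        using \<open>walk W ?F xs \<and> distinct xs \<and> hd xs = u \<and> last xs = v\<close> by (rule uniq)
    qed
  qed (rule assms(2), rule ends)
qed

end

section \<open>Half-trees as topological components\<close>

lemma in_points_iff:
  "p \<in> points T \<longleftrightarrow> (\<forall>v. 0 \<le> p v) \<and> ((\<exists>v\<in>verts T. supp p = {v}) \<or> supp p \<in> edges T) \<and> sum p (supp p) = 1"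
  by (simp add: points_def realization_def)

lemma not_in_supp: "x \<notin> supp p \<Longrightarrow> p x = 0"
  by (simp add: supp_def)

lemma supp_vpoint [simp]: "supp (vpoint v) = {v}"
  by (auto simp: supp_def vpoint_def indicator_def)

lemma vpoint_apply: "vpoint a x = (if x = a then 1 else 0)"
  by (simp add: vpoint_def)

lemma vpoint_in_points: "v \<in> verts T \<Longrightarrow> vpoint v \<in> points T"
  by (simp add: in_points_iff) (simp add: vpoint_def)

lemma point_eq_vpoint:
  assumes "p \<in> points T" "supp p = {v}"
  shows "p = vpoint v"
proof
  fix x
  have "p v = 1"
    using assms by (simp add: in_points_iff)
  then show "p x = vpoint v x"
    using assms(2) not_in_supp[of x p] by (cases "x = v") (auto simp: vpoint_def)
qed

lemma supp_nonempty: "p \<in> points T \<Longrightarrow> supp p \<noteq> {}"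
  by (auto simp: in_points_iff)

lemma point_pos_iff: "p \<in> points T \<Longrightarrow> 0 < p v \<longleftrightarrow> v \<in> supp p"
  by (auto simp: in_points_iff supp_def less_le)

definition segment_point :: "('v \<Rightarrow> real) \<Rightarrow> 'v \<Rightarrow> real \<Rightarrow> 'v \<Rightarrow> real" where
  "segment_point p v t = (\<lambda>x. (1 - t) * p x + t * vpoint v x)"

lemma segment_point_0 [simp]: "segment_point p v 0 = p"
  and segment_point_1 [simp]: "segment_point p v 1 = vpoint v"
  by (simp_all add: segment_point_def)

lemma connected_segment: "connected (segment_point p v ` {0..1})"
  unfolding segment_point_def
  by (intro connected_continuous_image continuous_on_coordinatewise_then_product continuous_intros) auto

context
  fixes T :: "('a, 'v) gtree"
  assumes tree: "tree (verts T) (edges T)"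
begin

interpretation tree "verts T" "edges T"
  by (rule tree)

lemma supp_subset_verts: "p \<in> points T \<Longrightarrow> supp p \<subseteq> verts T"
  using edge_subset by (auto simp: in_points_iff)

lemma finite_supp: "p \<in> points T \<Longrightarrow> finite (supp p)"
  by (auto simp: in_points_iff elim: edgeE)

lemma supp_segment_point:
  assumes "p \<in> points T" "0 < t" "t < 1"
  shows "supp (segment_point p v t) = insert v (supp p)"
proof -
  have "segment_point p v t x \<noteq> 0 \<longleftrightarrow> x = v \<or> p x \<noteq> 0" for x
  proof -
    have "0 \<le> (1 - t) * p x" "0 \<le> t * vpoint v x"
      using assms by (simp_all add: in_points_iff vpoint_def)
    then show ?thesis
      using assms by (auto simp: segment_point_def add_nonneg_eq_0_iff vpoint_def)
  qed
  then show ?thesis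
    by (auto simp: supp_def)
qed

lemma segment_in_points:
  assumes p: "p \<in> points T" and v: "v \<in> verts T"
    and adj: "insert v (supp p) \<in> edges T \<or> supp p = {v}" and t: "0 \<le> t" "t \<le> 1"
  shows "segment_point p v t \<in> points T"
proof -
  consider "t = 0" | "t = 1" | "0 < t" "t < 1"
    using t by linarith
  then show ?thesis
  proof cases
    case 3
    have "sum (segment_point p v t) (insert v (supp p)) = (1 - t) * sum p (insert v (supp p)) + t * sum (vpoint v) (insert v (supp p))"
      by (simp add: segment_point_def sum.distrib sum_distrib_left)
    also have "sum p (insert v (supp p)) = sum p (supp p)"
      using finite_supp[OF p] by (intro sum.mono_neutral_right) (auto simp: supp_def)
    also have "sum (vpoint v) (insert v (supp p)) = sum (vpoint v) {v}"
      using finite_supp[OF p] by (intro sum.mono_neutral_right) (auto simp: vpoint_def)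
    also have "(1 - t) * sum p (supp p) + t * sum (vpoint v) {v} = 1"
      using p by (simp add: in_points_iff vpoint_def)
    finally have "sum (segment_point p v t) (insert v (supp p)) = 1" .
    moreover have "0 \<le> segment_point p v t x" for x
      using p t by (simp add: in_points_iff segment_point_def vpoint_def)
    ultimately show ?thesis
      using adj v supp_segment_point[OF p 3, of v] by (auto simp: in_points_iff)
  qed (use p v vpoint_in_points in auto)
qed

definition touching :: "'v set \<Rightarrow> ('v \<Rightarrow> real) set" where
  "touching B = {p \<in> points T. supp p \<inter> B \<noteq> {}}"

lemma touching_segment:
  assumes p: "p \<in> touching B" and v: "v \<in> B" "v \<in> verts T"
    and adj: "insert v (supp p) \<in> edges T \<or> supp p = {v}"
  shows "connected_component (touching B) p (vpoint v)"
proof -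
  have "segment_point p v ` {0..1} \<subseteq> touching B"
  proof (intro image_subsetI)
    fix t :: real assume "t \<in> {0..1}"
    then consider "t = 0" | "t = 1" | "0 < t" "t < 1"
      by fastforce
    then show "segment_point p v t \<in> touching B"
    proof cases
      case 3
      then show ?thesis
        using assms segment_in_points[of p v t] supp_segment_point[of p t v] by (auto simp: touching_def)
    qed (use p v vpoint_in_points[of v T] in \<open>auto simp: touching_def\<close>)
  qed
  moreover have "p \<in> segment_point p v ` {0..1}"
    by (rule image_eqI[of _ _ 0]) simp_all
  moreover have "vpoint v \<in> segment_point p v ` {0..1}"
    by (rule image_eqI[of _ _ 1]) simp_all
  ultimately show ?thesis
    unfolding connected_component_def
    by (intro exI[of _ "segment_point p v ` {0..1}"] conjI connected_segment)
qed

text \<open>The vertices of the side are joined to \<open>b\<close> by segments, one edge after the other, and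
  every other point is joined to a vertex of the side inside the edge that carries it.\<close>

lemma connected_touching_side:
  assumes e: "{a, b} \<in> edges T"
  shows "connected (touching (side (edges T) a b))"
proof -
  let ?B = "side (edges T) a b"
  have vert: "connected_component (touching ?B) (vpoint b) (vpoint x)" if "x \<in> ?B" for x
  proof -
    have "(b, x) \<in> (adjacency (edges T - {{a, b}}))\<^sup>*"
      using that by (simp add: side_def)
    then have "x \<in> ?B \<and> connected_component (touching ?B) (vpoint b) (vpoint x)"
    proof (induction rule: rtrancl_induct)
      case base
      have "vpoint b \<in> touching ?B"
        using edgeD[OF e] by (simp add: touching_def vpoint_in_points side_self)
      then show ?case
        by (simp add: side_self)
    next
      case (step y z)
      then have yz: "{y, z} \<in> edges T" "{y, z} \<noteq> {a, b}"
        by (auto simp: adjacency_def)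
      then have z: "z \<in> ?B"
        using step side_edge[OF yz] by blast
      have "vpoint y \<in> touching ?B"
        using edgeD[OF yz(1)] step by (simp add: touching_def vpoint_in_points)
      then have "connected_component (touching ?B) (vpoint y) (vpoint z)"
        using z yz edgeD[OF yz(1)] by (intro touching_segment) (auto simp: insert_commute)
      then show ?case
        using z step connected_component_trans by metis
    qed
    then show ?thesis ..
  qed
  have "connected_component (touching ?B) (vpoint b) p" if p: "p \<in> touching ?B" for p
  proof -
    obtain v where v: "v \<in> supp p" "v \<in> ?B"
      using p by (auto simp: touching_def)
    have pp: "p \<in> points T"
      using p by (simp add: touching_def)
    have "connected_component (touching ?B) p (vpoint v)"
      using v p supp_subset_verts[OF pp] pp
      by (intro touching_segment) (auto simp: in_points_iff insert_absorb)
    then show ?thesis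
      using vert[OF v(2)] connected_component_sym connected_component_trans by metis
  qed
  then show ?thesis
    unfolding connected_iff_connected_component
    using connected_component_sym connected_component_trans by metis
qed

text \<open>In the topology of pointwise convergence too, the side is open and closed in the complement of the
  origin: a point is on the side if some barycentric coordinate is positive at a vertex of the side,
  and off the side if some coordinate is positive at a vertex that is neither on the side nor the
  origin.\<close>

lemma half_tree_eq:
  assumes e: "{a, b} \<in> edges T"
  shows "half_tree T (a, b) = {p \<in> points T. supp p \<inter> side (edges T) a b \<noteq> {}}"
proof -
  let ?B = "side (edges T) a b"
  let ?U = "touching ?B"
  let ?P = "points T - {vpoint a}"
  have a: "a \<notin> ?B"
    using e by (rule origin_notin_side)
  have U: "?U \<subseteq> ?P" "vpoint b \<in> ?U"
    using a edgeD[OF e] by (auto simp: touching_def vpoint_in_points side_self)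
  define O1 :: "('v \<Rightarrow> real) set" where "O1 = (\<Union>v\<in>?B. {p. 0 < p v})"
  define O2 :: "('v \<Rightarrow> real) set" where "O2 = (\<Union>v\<in>- (insert a ?B). {p. 0 < p v})"
  have open_pos: "open {p :: 'v \<Rightarrow> real. 0 < p v}" for v
    by (intro open_Collect_less continuous_on_product_coordinates continuous_intros)
  have opens: "open O1" "open O2"
    unfolding O1_def O2_def by (intro open_UN ballI open_pos)+
  have O1: "p \<in> O1 \<longleftrightarrow> supp p \<inter> ?B \<noteq> {}" and O2: "p \<in> O2 \<longleftrightarrow> \<not> supp p \<subseteq> insert a ?B" if "p \<in> points T" for p
    using point_pos_iff[OF that] by (auto simp: O1_def O2_def)
  have cover: "?P \<subseteq> O1 \<union> O2"
  proof
    fix p assume p: "p \<in> ?P"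
    then have "supp p \<noteq> {a}"
      using point_eq_vpoint[of p T a] by auto
    then show "p \<in> O1 \<union> O2"
      using p O1[of p] O2[of p] supp_nonempty[of p T] by auto
  qed
  have disj: "O1 \<inter> O2 \<inter> ?P = {}"
  proof (rule ccontr)
    assume "O1 \<inter> O2 \<inter> ?P \<noteq> {}"
    then obtain p where p: "p \<in> points T" "p \<in> O1" "p \<in> O2"
      by blast
    then obtain v w where vw: "v \<in> supp p" "v \<in> ?B" "w \<in> supp p" "w \<noteq> a" "w \<notin> ?B"
      using O1 O2 by fast
    then have "supp p \<in> edges T"
      using p by (auto simp: in_points_iff)
    moreover obtain x y where "supp p = {x, y}"
      using \<open>supp p \<in> edges T\<close> by (rule edgeE)
    then have "supp p = {v, w}"
      using vw by auto
    ultimately have "{v, w} \<in> edges T"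
      by simp
    then show False
      using edge_crossing[of v w a b] vw e by auto
  qed
  have maximal: "D \<subseteq> ?U" if D: "connected D" "D \<subseteq> ?P" "D \<inter> ?U \<noteq> {}" for D
  proof -
    have "O1 \<inter> D \<noteq> {}"
      using D(3) O1 by (auto simp: touching_def)
    then have "O2 \<inter> D = {}"
      using connectedD[OF D(1) opens] D(2) cover disj by blast
    then show ?thesis
      using D(2) cover O1 by (auto simp: touching_def)
  qed
  have "?U \<in> components ?P"
    unfolding in_components_maximal using U connected_touching_side[OF e] maximal by blast
  moreover have sub: "open_edge T {a, b} \<subseteq> ?U"
    by (auto simp: open_edge_def touching_def side_self)
  moreover have "C = ?U" if C: "C \<in> components ?P" "open_edge T {a, b} \<subseteq> C" for C
  proof -
    let ?m = "segment_point (vpoint a) b (1/2)"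
    have "?m \<in> open_edge T {a, b}"
      using e edgeD[OF e] vpoint_in_points[of a T] segment_in_points[of "vpoint a" b "1/2"]
        supp_segment_point[of "vpoint a" "1/2" b]
      by (auto simp: open_edge_def insert_commute)
    then have "C \<inter> ?U \<noteq> {}"
      using C sub by blast
    then show ?thesis
      using components_nonoverlap[OF C(1) \<open>?U \<in> components ?P\<close>] by blast
  qed
  ultimately have "{C \<in> components ?P. open_edge T {a, b} \<subseteq> C} = {?U}"
    by blast
  then show ?thesis
    unfolding half_tree_def by (simp add: touching_def)
qed

end

section \<open>Groups acting on trees without inversions\<close>

lemma finite_image_kernel:
  assumes "finite (f ` A)" "\<And>x y. x \<in> A \<Longrightarrow> y \<in> A \<Longrightarrow> f x = f y \<Longrightarrow> g x = g y"
  shows "finite (g ` A)"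
proof -
  have "g ` A \<subseteq> (\<lambda>y. g (inv_into A f y)) ` (f ` A)"
  proof
    fix z assume "z \<in> g ` A"
    then obtain x where x: "x \<in> A" "z = g x"
      by blast
    then have "g (inv_into A f (f x)) = z"
      using assms(2)[of "inv_into A f (f x)" x] by (simp add: inv_into_into f_inv_into_f)
    then show "z \<in> (\<lambda>y. g (inv_into A f y)) ` (f ` A)"
      using x by blast
  qed
  then show ?thesis
    by (rule finite_subset) (intro finite_imageI assms(1))
qed

locale tree_action = group_action G "verts T" "act T" + tree "verts T" "edges T"
  for G :: "('a, 'b) monoid_scheme" (structure) and T :: "('a, 'v) gtree" +
  assumes edge_act_closed: "g \<in> carrier G \<Longrightarrow> e \<in> edges T \<Longrightarrow> edge_act T g e \<in> edges T"
    and no_inversion: "g \<in> carrier G \<Longrightarrow> {u, v} \<in> edges T \<Longrightarrow> act T g u = v \<Longrightarrow> act T g v \<noteq> u"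
begin

sublocale group G
  using group_hom group_hom.axioms(1) by blast

abbreviation branch :: "'v \<Rightarrow> 'v \<Rightarrow> 'v set" where
  "branch \<equiv> side (edges T)"

lemma act_closed [simp]: "g \<in> carrier G \<Longrightarrow> x \<in> verts T \<Longrightarrow> act T g x \<in> verts T"
  using element_image by blast

lemma act_mult: "g \<in> carrier G \<Longrightarrow> h \<in> carrier G \<Longrightarrow> x \<in> verts T \<Longrightarrow> act T (g \<otimes> h) x = act T g (act T h x)"
  using composition_rule by blast

lemma act_one [simp]: "x \<in> verts T \<Longrightarrow> act T \<one> x = x"
  using id_eq_one by (metis restrict_apply')

lemma act_inv_act [simp]: "g \<in> carrier G \<Longrightarrow> x \<in> verts T \<Longrightarrow> act T (inv g) (act T g x) = x"
  using orbit_sym_aux by blast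

lemma act_act_inv [simp]: "g \<in> carrier G \<Longrightarrow> x \<in> verts T \<Longrightarrow> act T g (act T (inv g) x) = x"
  using act_inv_act[of "inv g" x] by simp

lemma act_eq_iff: "g \<in> carrier G \<Longrightarrow> x \<in> verts T \<Longrightarrow> y \<in> verts T \<Longrightarrow> act T g x = act T g y \<longleftrightarrow> x = y"
  by (metis act_inv_act)

lemma act_eq_swap:
  "g \<in> carrier G \<Longrightarrow> x \<in> verts T \<Longrightarrow> y \<in> verts T \<Longrightarrow> act T g x = y \<longleftrightarrow> x = act T (inv g) y"
  by (metis act_inv_act act_act_inv)

lemma edge_act_pair [simp]: "edge_act T g {a, b} = {act T g a, act T g b}"
  by (simp add: edge_act_def)

lemma edge_act_one: "e \<in> edges T \<Longrightarrow> edge_act T \<one> e = e"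
  by (elim edgeE) simp

lemma edge_act_mult:
  "g \<in> carrier G \<Longrightarrow> h \<in> carrier G \<Longrightarrow> e \<in> edges T \<Longrightarrow> edge_act T (g \<otimes> h) e = edge_act T g (edge_act T h e)"
  by (elim edgeE) (simp add: act_mult)

lemma edge_act_inv_act: "g \<in> carrier G \<Longrightarrow> e \<in> edges T \<Longrightarrow> edge_act T (inv g) (edge_act T g e) = e"
  by (elim edgeE) simp

lemma edge_act_act_inv: "g \<in> carrier G \<Longrightarrow> e \<in> edges T \<Longrightarrow> edge_act T g (edge_act T (inv g) e) = e"
  by (elim edgeE) simp

lemma act_edge: "g \<in> carrier G \<Longrightarrow> {u, v} \<in> edges T \<Longrightarrow> {act T g u, act T g v} \<in> edges T"
  using edge_act_closed[of g "{u, v}"] by simp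

lemma act_mem_branch_imp:
  assumes "g \<in> carrier G" "{a, b} \<in> edges T" "x \<in> branch a b"
  shows "act T g x \<in> branch (act T g a) (act T g b)"
proof -
  have "(b, x) \<in> (adjacency (edges T - {{a, b}}))\<^sup>*"
    using assms(3) by (simp add: side_def)
  then show ?thesis
  proof (induction rule: rtrancl_induct)
    case base
    show ?case
      by (rule side_self)
  next
    case (step y z)
    then have yz: "{y, z} \<in> edges T" "{y, z} \<noteq> {a, b}"
      by (auto simp: adjacency_def)
    have "{act T g y, act T g z} \<noteq> {act T g a, act T g b}"
      using yz edge_act_inv_act[OF assms(1) yz(1)] edge_act_inv_act[OF assms(1,2)] by force
    then show ?case
      using step.IH side_edge[OF act_edge[OF assms(1) yz(1)]] by blast
  qed
qed

lemma act_mem_branch_iff: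
  assumes "g \<in> carrier G" "{a, b} \<in> edges T" "x \<in> verts T"
  shows "act T g x \<in> branch (act T g a) (act T g b) \<longleftrightarrow> x \<in> branch a b"
  using act_mem_branch_imp[OF assms(1,2)]
    act_mem_branch_imp[of "inv g" "act T g a" "act T g b" "act T g x"]
    assms act_edge[OF assms(1,2)] edgeD[OF assms(2)] by auto

lemma act_branch:
  assumes "g \<in> carrier G" "{a, b} \<in> edges T"
  shows "act T g ` branch a b = branch (act T g a) (act T g b)"
proof
  show "branch (act T g a) (act T g b) \<subseteq> act T g ` branch a b"
  proof
    fix y assume y: "y \<in> branch (act T g a) (act T g b)"
    then have "y \<in> verts T"
      using side_subset[OF act_edge[OF assms]] by blast
    then have "y = act T g (act T (inv g) y)" "act T (inv g) y \<in> branch a b"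
      using y act_mem_branch_iff[OF assms, of "act T (inv g) y"] assms(1) by auto
    then show "y \<in> act T g ` branch a b"
      by (rule image_eqI)
  qed
qed (use act_mem_branch_imp[OF assms] in auto)

lemma mem_act_branch_iff:
  assumes "g \<in> carrier G" "{a, b} \<in> edges T" "x \<in> verts T"
  shows "x \<in> act T g ` branch a b \<longleftrightarrow> act T (inv g) x \<in> branch a b"
  using act_branch[OF assms(1,2)] act_mem_branch_iff[OF assms(1,2), of "act T (inv g) x"] assms by simp

lemma act_separating:
  assumes "g \<in> carrier G" "x \<in> verts T" "y \<in> verts T" "e \<in> separating (edges T) x y"
  shows "edge_act T g e \<in> separating (edges T) (act T g x) (act T g y)"
proof -
  obtain a b where ab: "e = {a, b}" "{a, b} \<in> edges T" "x \<notin> branch a b" "y \<in> branch a b"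
    using assms(4) by (auto simp: separating_def)
  then show ?thesis
    unfolding separating_def
    using act_edge[OF assms(1) ab(2)] act_mem_branch_iff[OF assms(1) ab(2)] assms(2,3) by auto
qed

section \<open>Points and elliptic elements\<close>

lemma supp_pt_act:
  assumes "g \<in> carrier G" "p \<in> points T"
  shows "supp (pt_act G T g p) = act T g ` supp p"
proof -
  have sub: "supp p \<subseteq> verts T"
    using supp_subset_verts[OF tree_axioms assms(2)] .
  show ?thesis
  proof (intro equalityI subsetI)
    fix x assume "x \<in> supp (pt_act G T g p)"
    then have "x \<in> verts T" "act T (inv g) x \<in> supp p"
      by (auto simp: supp_def pt_act_def split: if_splits)
    then show "x \<in> act T g ` supp p"
      using assms by (intro image_eqI[of _ _ "act T (inv g) x"]) auto
  next
    fix x assume "x \<in> act T g ` supp p"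
    then obtain y where "y \<in> supp p" "x = act T g y"
      by blast
    then show "x \<in> supp (pt_act G T g p)"
      using sub assms by (auto simp: supp_def pt_act_def)
  qed
qed

lemma pt_act_closed:
  assumes "g \<in> carrier G" "p \<in> points T"
  shows "pt_act G T g p \<in> points T"
proof -
  have sub: "supp p \<subseteq> verts T"
    using supp_subset_verts[OF tree_axioms assms(2)] .
  have "inj_on (act T g) (supp p)"
    using inj_prop[OF assms(1)] sub by (rule inj_on_subset)
  then have "sum (pt_act G T g p) (act T g ` supp p) = (\<Sum>v\<in>supp p. pt_act G T g p (act T g v))"
    by (simp add: sum.reindex)
  also have "\<dots> = sum p (supp p)"
    using sub assms by (intro sum.cong) (auto simp: pt_act_def)
  finally have "sum (pt_act G T g p) (act T g ` supp p) = 1"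
    using assms by (simp add: in_points_iff)
  moreover have "(\<exists>v\<in>verts T. act T g ` supp p = {v}) \<or> act T g ` supp p \<in> edges T"
    using assms edge_act_closed[OF assms(1)] by (auto simp: in_points_iff edge_act_def)
  moreover have "0 \<le> pt_act G T g p v" for v
    using assms by (simp add: in_points_iff pt_act_def)
  ultimately show ?thesis
    by (simp add: in_points_iff supp_pt_act[OF assms])
qed

text \<open>A fixed point inside an edge forces both ends to be fixed, as they cannot be exchanged. So fixed
  points may be sought among the vertices.\<close>

lemma fixed_point_fixes_supp:
  assumes "g \<in> carrier G" "p \<in> points T" "pt_act G T g p = p" "v \<in> supp p"
  shows "act T g v = v"
proof -
  have fixed: "act T g ` supp p = supp p"
    using supp_pt_act[OF assms(1,2)] assms(3) by simp
  show ?thesis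
  proof (cases "supp p \<in> edges T")
    case True
    then obtain u w where uw: "supp p = {u, w}"
      by (rule edgeE)
    then show ?thesis
      using fixed assms(4) no_inversion[OF assms(1), of u w] True by (auto simp: doubleton_eq_iff)
  next
    case False
    then obtain u where "supp p = {u}"
      using assms(2) by (auto simp: in_points_iff)
    then show ?thesis
      using fixed assms(4) by auto
  qed
qed

lemma pt_act_vpoint:
  assumes "g \<in> carrier G" "v \<in> verts T"
  shows "pt_act G T g (vpoint v) = vpoint (act T g v)"
  using assms act_eq_swap[OF assms]
  by (auto simp: pt_act_def vpoint_def indicator_def fun_eq_iff)

lemma elliptic_iff:
  assumes "g \<in> carrier G"
  shows "elliptic G T g \<longleftrightarrow> (\<exists>v\<in>verts T. act T g v = v)"
proof
  assume "elliptic G T g"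
  then obtain p where p: "p \<in> points T" "pt_act G T g p = p"
    by (auto simp: elliptic_def)
  then obtain v where "v \<in> supp p"
    using supp_nonempty by blast
  then show "\<exists>v\<in>verts T. act T g v = v"
    using fixed_point_fixes_supp[OF assms p] supp_subset_verts[OF tree_axioms p(1)] by blast
next
  assume "\<exists>v\<in>verts T. act T g v = v"
  then obtain v where "v \<in> verts T" "act T g v = v"
    by blast
  then show "elliptic G T g"
    unfolding elliptic_def
    using pt_act_vpoint[OF assms] by (intro bexI[of _ "vpoint v"]) (auto simp: vpoint_in_points)
qed

section \<open>Edges shifted into themselves and the minimal subtree\<close>

text \<open>In geometric terms: \<open>h\<close> has no fixed point, and its axis runs through
  \<open>{a, b}\<close> in the direction from \<open>a\<close> to \<open>b\<close>.\<close>

definition shifts :: "'a \<Rightarrow> 'v \<Rightarrow> 'v \<Rightarrow> bool" where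
  "shifts h a b \<longleftrightarrow> h \<in> carrier G \<and> {a, b} \<in> edges T \<and> act T h ` branch a b \<subset> branch a b"

definition axis_edges :: "'a set \<Rightarrow> 'v set set" where
  "axis_edges H = {{a, b} | a b. \<exists>h\<in>H. shifts h a b}"

lemma shifts_flip:
  assumes "shifts h a b"
  shows "shifts (inv h) b a"
proof -
  have h: "h \<in> carrier G" and e: "{a, b} \<in> edges T" and sh: "act T h ` branch a b \<subset> branch a b"
    using assms by (auto simp: shifts_def)
  have e': "{b, a} \<in> edges T"
    using e by (simp add: insert_commute)
  have sub: "act T (inv h) ` branch b a \<subseteq> branch b a"
  proof (intro image_subsetI)
    fix x assume x: "x \<in> branch b a"
    then have xv: "x \<in> verts T"
      using side_subset[OF e'] by blast
    then have "x \<notin> act T h ` branch a b"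
      using x sh mem_side_flip[OF e] by blast
    then show "act T (inv h) x \<in> branch b a"
      using mem_act_branch_iff[OF h e xv] mem_side_flip[OF e, of "act T (inv h) x"] xv h by simp
  qed
  obtain y where y: "y \<in> branch a b" "y \<notin> act T h ` branch a b"
    using sh by blast
  then have yv: "y \<in> verts T"
    using side_subset[OF e] by blast
  have "act T (inv h) y \<in> branch b a"
    using y mem_act_branch_iff[OF h e yv] mem_side_flip[OF e, of "act T (inv h) y"] yv h by simp
  moreover have "act T (inv h) y \<notin> act T (inv h) ` branch b a"
  proof
    assume "act T (inv h) y \<in> act T (inv h) ` branch b a"
    then obtain z where z: "z \<in> branch b a" "act T (inv h) y = act T (inv h) z"
      by blast
    then have "y = z"
      using act_eq_iff[of "inv h" y z] h yv side_subset[OF e'] by auto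
    then show False
      using y z mem_side_flip[OF e yv] by blast
  qed
  ultimately show ?thesis
    using sub h e' unfolding shifts_def by blast
qed

lemma shifts_conj:
  assumes "shifts h a b" "g \<in> carrier G"
  shows "shifts (g \<otimes> h \<otimes> inv g) (act T g a) (act T g b)"
proof -
  have h: "h \<in> carrier G" and e: "{a, b} \<in> edges T" and sh: "act T h ` branch a b \<subset> branch a b"
    using assms by (auto simp: shifts_def)
  note sub = side_subset[OF e]
  have "act T (g \<otimes> h \<otimes> inv g) ` act T g ` branch a b = act T g ` act T h ` branch a b"
    using sub h assms(2) by (force simp: image_image act_mult)
  also have "\<dots> \<subset> act T g ` branch a b"
    using sh inj_on_subset[OF inj_prop[OF assms(2)] sub] by (meson image_strict_mono)
  finally show ?thesis
    using h e assms(2) act_edge[OF assms(2) e] by (simp add: shifts_def act_branch)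
qed

lemma shifts_pow_image:
  assumes "shifts h a b" "(m :: nat) < n"
  shows "act T (h [^] n) ` branch a b \<subset> act T (h [^] m) ` branch a b"
proof -
  have h: "h \<in> carrier G" and e: "{a, b} \<in> edges T" and sh: "act T h ` branch a b \<subset> branch a b"
    using assms by (auto simp: shifts_def)
  note sub = side_subset[OF e]
  have step: "act T (h [^] Suc k) ` branch a b \<subset> act T (h [^] k) ` branch a b" for k
  proof -
    have "act T (h [^] Suc k) ` branch a b = act T (h [^] k) ` act T h ` branch a b"
      using sub h by (force simp: image_image act_mult)
    also have "\<dots> \<subset> act T (h [^] k) ` branch a b"
      using sh inj_on_subset[OF inj_prop[of "h [^] k"] sub] h by (meson image_strict_mono nat_pow_closed)
    finally show ?thesis .
  qed
  show ?thesis
    using assms(2)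
  proof (induction n)
    case (Suc n)
    then show ?case
      using step[of n] by (cases "m = n") auto
  qed simp
qed

lemma inj_shifted_edges:
  assumes sh: "shifts h a b"
  shows "inj (\<lambda>n :: nat. edge_act T (h [^] n) {a, b})"
proof -
  have h: "h \<in> carrier G" and e: "{a, b} \<in> edges T"
    using sh by (auto simp: shifts_def)
  let ?e = "\<lambda>n :: nat. edge_act T (h [^] n) {a, b}"
  have pe: "{act T (h [^] n) a, act T (h [^] n) b} \<in> edges T" for n :: nat
    using act_edge[OF _ e] h by simp
  have pb: "branch (act T (h [^] n) a) (act T (h [^] n) b) = act T (h [^] n) ` branch a b" for n :: nat
    using act_branch[OF _ e] h by simp
  have ne: "?e m \<noteq> ?e n" if "m < n" for m n
  proof
    assume eq: "?e m = ?e n"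
    have lt: "act T (h [^] n) ` branch a b \<subset> act T (h [^] m) ` branch a b"
      using shifts_pow_image[OF sh that] .
    consider "act T (h [^] m) a = act T (h [^] n) a" "act T (h [^] m) b = act T (h [^] n) b"
      | "act T (h [^] m) a = act T (h [^] n) b" "act T (h [^] m) b = act T (h [^] n) a"
      using eq by (auto simp: doubleton_eq_iff)
    then show False
    proof cases
      case 1
      then show False
        using lt pb by (metis less_irrefl)
    next
      case 2
      have "act T (h [^] n) b \<in> act T (h [^] m) ` branch a b"
        using lt side_self[of b "edges T" a] by blast
      then have "act T (h [^] m) a \<in> act T (h [^] m) ` branch a b"
        using 2(1) by simp
      then show False
        using pb[of m] origin_notin_side[OF pe[of m]] by blast
    qed
  qed
  show ?thesis
  proof (rule injI)
    fix m n assume "?e m = ?e n"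
    then show "m = n"
      using ne[of m n] ne[of n m] by (cases m n rule: linorder_cases) (metis, assumption, metis)
  qed
qed

text \<open>The edges \<open>h\<^sup>n {a, b}\<close> beyond which \<open>x\<close> lies are pairwise different
  and separate \<open>a\<close> from \<open>x\<close>.\<close>

lemma shifts_escape:
  assumes sh: "shifts h a b" and x: "x \<in> verts T"
  shows "finite {n :: nat. act T (inv (h [^] n)) x \<in> branch a b}"
proof (rule finite_imageD)
  have h: "h \<in> carrier G" and e: "{a, b} \<in> edges T"
    using sh by (auto simp: shifts_def)
  let ?N = "{n :: nat. act T (inv (h [^] n)) x \<in> branch a b}"
  let ?e = "\<lambda>n :: nat. edge_act T (h [^] n) {a, b}"
  have pe: "{act T (h [^] n) a, act T (h [^] n) b} \<in> edges T" for n :: nat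
    using act_edge[OF _ e] h by simp
  have pb: "branch (act T (h [^] n) a) (act T (h [^] n) b) = act T (h [^] n) ` branch a b" for n :: nat
    using act_branch[OF _ e] h by simp
  show "inj_on ?e ?N"
    using inj_shifted_edges[OF sh] by (rule inj_on_subset) simp
  have "?e n \<in> separating (edges T) a x" if "n \<in> ?N" for n
  proof -
    have "x \<in> act T (h [^] n) ` branch a b"
      using that mem_act_branch_iff[OF _ e x] h by simp
    moreover have "act T (h [^] n) ` branch a b \<subseteq> branch a b"
    proof (cases "n = 0")
      case True
      then show ?thesis
        using side_subset[OF e] by auto
    next
      case False
      then have "act T (h [^] n) ` branch a b \<subset> act T (h [^] (0::nat)) ` branch a b"
        by (intro shifts_pow_image[OF sh]) simp
      moreover have "act T (h [^] (0::nat)) ` branch a b = branch a b"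
        using side_subset[OF e] by force
      ultimately show ?thesis
        by auto
    qed
    ultimately have "a \<notin> branch (act T (h [^] n) a) (act T (h [^] n) b)"
        "x \<in> branch (act T (h [^] n) a) (act T (h [^] n) b)"
      using pb[of n] origin_notin_side[OF e] by auto
    then show ?thesis
      using pe[of n] unfolding separating_def edge_act_pair by blast
  qed
  then have "?e ` ?N \<subseteq> separating (edges T) a x"
    by blast
  then show "finite (?e ` ?N)"
    by (rule finite_subset) (intro finite_separating edgeD(1)[OF e] x)
qed

lemma shifts_attract:
  assumes sh: "shifts h a b" and x: "x \<in> verts T"
  shows "finite {n :: nat. act T (h [^] n) x \<notin> branch a b}"
proof -
  have h: "h \<in> carrier G" and e: "{a, b} \<in> edges T"
    using sh by (auto simp: shifts_def)
  have "act T (inv ((inv h) [^] n)) x = act T (h [^] n) x" for n :: nat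
    using h by (simp add: nat_pow_inv)
  then show ?thesis
    using shifts_escape[OF shifts_flip[OF sh] x] mem_side_flip[OF e] h x by simp
qed

lemma shifts_no_fixed_vertex:
  assumes sh: "shifts h a b" and x: "x \<in> verts T"
  shows "act T h x \<noteq> x"
proof
  assume fixed: "act T h x = x"
  have h: "h \<in> carrier G"
    using sh by (auto simp: shifts_def)
  have pow: "act T (h [^] n) x = x" for n :: nat
    by (induction n) (use h x fixed in \<open>simp_all add: act_mult\<close>)
  have "act T (inv (h [^] n)) x = x" for n :: nat
    using act_eq_swap[of "h [^] n" x x] pow h x by simp
  then show False
    using shifts_attract[OF sh x] shifts_escape[OF sh x] pow by (cases "x \<in> branch a b") auto
qed

text \<open>Two different edges cut the tree into three pieces. Depending on how the pieces are distributed, a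
  side of \<open>{u, v}\<close> and its image under \<open>h\<close> are nested, or one of the two
  sides is disjoint from its image.\<close>

lemma moved_edge_cases:
  assumes h: "h \<in> carrier G" and e: "{u, v} \<in> edges T" and moved: "edge_act T h {u, v} \<noteq> {u, v}"
  obtains "shifts h u v" | "shifts (inv h) u v"
    | "act T h ` branch u v \<inter> branch u v = {}" | "act T h ` branch v u \<inter> branch v u = {}"
proof -
  have e': "{v, u} \<in> edges T"
    using e by (simp add: insert_commute)
  let ?u = "act T h u" and ?v = "act T h v"
  have he: "{?u, ?v} \<in> edges T" and he': "{?v, ?u} \<in> edges T"
    using act_edge[OF h] e e' by auto
  have ne: "{?u, ?v} \<noteq> {u, v}" "{?v, ?u} \<noteq> {v, u}" "{u, v} \<noteq> {?v, ?u}" "{v, u} \<noteq> {?u, ?v}"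
    using moved by (auto simp: doubleton_eq_iff)
  have im: "act T h ` branch u v = branch ?u ?v" "act T h ` branch v u = branch ?v ?u"
    using act_branch[OF h] e e' by auto
  have same: "?u \<in> branch u v \<longleftrightarrow> ?v \<in> branch u v"
    using side_edge[OF he ne(1)] .
  have uv: "u \<in> verts T" "v \<in> verts T" "?u \<in> verts T" "?v \<in> verts T"
    using edgeD[OF e] h by auto
  show thesis
  proof (cases "?u \<in> branch u v")
    case False
    then have out: "?u \<notin> branch u v" "?v \<notin> branch u v"
      using same by auto
    show thesis
    proof (cases "v \<in> branch ?u ?v")
      case True
      have "branch u v \<subseteq> branch ?u ?v"
        using side_nested[OF e ne(1)[symmetric] he out(1) True] .
      then have sub: "branch u v \<subset> act T h ` branch u v"
        using out side_self[of ?v "edges T" ?u] im by blast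
      have "act T (inv h) ` branch u v \<subset> act T (inv h) ` act T h ` branch u v"
        using sub h side_subset[OF he]
        by (intro image_strict_mono inj_on_subset[OF inj_prop[of "inv h"]]) (auto simp: im)
      also have "\<dots> = branch u v"
        using h side_subset[OF e] by (force simp: image_image)
      finally show thesis
        using that(2) h e by (auto simp: shifts_def)
    next
      case False
      then have "v \<in> branch ?v ?u"
        using mem_side_flip[OF he] uv by blast
      then have "branch u v \<subseteq> branch ?v ?u"
        using side_nested[OF e ne(3) he' out(2)] by blast
      then show thesis
        using that(3) im side_flip[OF he] by blast
    qed
  next
    case True
    then have out: "?u \<notin> branch v u" "?v \<notin> branch v u"
      using same mem_side_flip[OF e] uv by auto
    show thesis
    proof (cases "u \<in> branch ?v ?u")
      case True
      have "branch v u \<subseteq> branch ?v ?u"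
        using side_nested[OF e' ne(2)[symmetric] he' out(2) True] .
      then have "branch ?u ?v \<subseteq> branch u v" "?u \<notin> branch ?u ?v" "?u \<in> branch u v"
        using side_flip[OF he] side_flip[OF e] side_subset[OF he] side_self[of ?u "edges T" ?v]
          \<open>?u \<in> branch u v\<close> by auto
      then show thesis
        using that(1) h e im by (auto simp: shifts_def)
    next
      case False
      then have "u \<in> branch ?u ?v"
        using mem_side_flip[OF he] uv by blast
      then have "branch v u \<subseteq> branch ?u ?v"
        using side_nested[OF e' ne(4) he out(1)] by blast
      then show thesis
        using that(4) im side_flip[OF he] by blast
    qed
  qed
qed

text \<open>If the axis of \<open>h\<close> does not run through \<open>{u, v}\<close>, it stays on the side of
  this edge that contains \<open>a\<close>, and \<open>h\<close> moves the other side off itself.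
  The fourth case of \<open>moved_edge_cases\<close> would move the side that contains the axis off
  itself.\<close>

lemma branch_off_axis:
  assumes sh: "shifts h a b" and e: "{u, v} \<in> edges T" "{u, v} \<noteq> {a, b}" and a: "a \<notin> branch u v"
  obtains "shifts h u v" | "shifts (inv h) u v" | "act T h ` branch u v \<inter> branch u v = {}"
proof -
  have h: "h \<in> carrier G" and e0: "{a, b} \<in> edges T" and im: "act T h ` branch a b \<subset> branch a b"
    using sh by (auto simp: shifts_def)
  have e': "{v, u} \<in> edges T" "{b, a} \<in> edges T"
    using e e0 by (simp_all add: insert_commute)
  have verts: "u \<in> verts T" "v \<in> verts T" "a \<in> verts T" "b \<in> verts T"
    using edgeD[OF e(1)] edgeD[OF e0] by auto
  have b: "b \<notin> branch u v"
    using side_edge[OF e0, of u v] a e(2) by metis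
  have ab: "a \<in> branch v u" "b \<in> branch v u"
    using a b mem_side_flip[OF e(1)] verts by auto
  have "edge_act T h {u, v} \<noteq> {u, v}"
  proof
    assume "edge_act T h {u, v} = {u, v}"
    then have "act T h u = u \<or> (act T h u = v \<and> act T h v = u)"
      by (auto simp: doubleton_eq_iff)
    then show False
      using no_inversion[OF h e(1)] shifts_no_fixed_vertex[OF sh verts(1)] by blast
  qed
  then show thesis
  proof (rule moved_edge_cases[OF h e(1)])
    assume disj: "act T h ` branch v u \<inter> branch v u = {}"
    show thesis
    proof (cases "v \<in> branch a b")
      case False
      have "branch a b \<subseteq> branch v u"
        using False ab e e' by (intro side_nested) (auto simp: insert_commute e0)
      moreover have "act T h b \<in> act T h ` branch a b"
        by (intro imageI side_self)
      ultimately show thesis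
        using disj im by blast
    next
      case True
      then have "v \<notin> branch b a"
        using mem_side_flip[OF e0] verts by blast
      then have sub: "branch b a \<subseteq> branch v u"
        using ab e e' by (intro side_nested) (auto simp: insert_commute)
      have "act T (inv h) a \<in> act T (inv h) ` branch b a"
        by (intro imageI side_self)
      then have "act T (inv h) a \<in> branch v u"
        using shifts_flip[OF sh] sub unfolding shifts_def by blast
      then have "act T h (act T (inv h) a) \<in> act T h ` branch v u"
        by (rule imageI)
      then have "a \<in> act T h ` branch v u"
        using h verts by simp
      then show thesis
        using ab disj by blast
    qed
  qed (use that in blast)+
qed

text \<open>Ping-pong. If the axes of \<open>h\<close> and \<open>k\<close> stay on different sides of
  \<open>{u, v}\<close>, then \<open>k\<close> moves the side of the axis of \<open>h\<close> into
  the side of the axis of \<open>k\<close>, and \<open>h\<close> moves the latter properly into the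
  former. So \<open>h k\<close> shifts \<open>{u, v}\<close>.\<close>

lemma axis_edges_between:
  assumes H: "subgroup H G" and h: "h \<in> H" "shifts h a b" and k: "k \<in> H" "shifts k c d"
    and e: "{u, v} \<in> edges T" "{u, v} \<noteq> {a, b}" "{u, v} \<noteq> {c, d}"
    and a: "a \<notin> branch u v" and c: "c \<in> branch u v"
  shows "{u, v} \<in> axis_edges H"
proof -
  have e': "{v, u} \<in> edges T"
    using e by (simp add: insert_commute)
  have G: "h \<in> carrier G" "k \<in> carrier G"
    using h k by (auto simp: shifts_def)
  have inv: "inv h \<in> H" "inv k \<in> H" "h \<otimes> k \<in> H"
    using H h k by (auto simp: subgroup.m_inv_closed subgroup.m_closed)
  have c': "c \<notin> branch v u"
    using c mem_side_flip[OF e'] side_subset[OF e(1)] by blast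
  have axis: "{u, v} \<in> axis_edges H" if "shifts l u v \<or> shifts l v u" "l \<in> H" for l
    using that by (auto simp: axis_edges_def insert_commute)
  show ?thesis
  proof (rule branch_off_axis[OF h(2) e(1,2) a])
    assume hB: "act T h ` branch u v \<inter> branch u v = {}"
    have vu: "{v, u} \<noteq> {c, d}"
      using e(3) by (simp add: insert_commute)
    show ?thesis
    proof (rule branch_off_axis[OF k(2) e' vu c'])
      assume kA: "act T k ` branch v u \<inter> branch v u = {}"
      have verts: "act T l ` branch x y \<subseteq> verts T" if "l \<in> carrier G" "{x, y} \<in> edges T" for l x y
        using side_subset[OF that(2)] that(1) by auto
      have "act T k ` branch v u \<subseteq> branch u v"
        using kA side_flip[OF e'] verts[OF G(2) e'] by blast
      then have 1: "act T h ` act T k ` branch v u \<subseteq> act T h ` branch u v"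
        by (rule image_mono)
      have 2: "act T h ` branch u v \<subseteq> branch v u"
        using hB side_flip[OF e(1)] verts[OF G(1) e(1)] by blast
      \<comment> \<open>equality would mean that \<open>h\<close> inverts \<open>{u, v}\<close>\<close>
      have 3: "act T h ` branch u v \<noteq> branch v u"
      proof
        assume eq: "act T h ` branch u v = branch v u"
        then have "act T h v \<in> branch v u" "act T h u \<notin> branch v u"
          using act_branch[OF G(1) e(1)] origin_notin_side[OF act_edge[OF G(1) e(1)]]
            side_self[of "act T h v" "edges T" "act T h u"] by auto
        then have "act T h v = u" "act T h u = v"
          using edge_crossing[OF act_edge[OF G(1) e']] e' by auto
        then show False
          using no_inversion[OF G(1) e(1)] by blast
      qed
      have "act T (h \<otimes> k) ` branch v u = act T h ` act T k ` branch v u"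
        using side_subset[OF e'] G by (force simp: image_image act_mult)
      then have "shifts (h \<otimes> k) v u"
        using 1 2 3 G e' unfolding shifts_def by auto
      then show ?thesis
        using axis inv by blast
    qed (use axis k inv in blast)+
  qed (use axis h inv in blast)+
qed

lemma axis_edges_subset: "axis_edges H \<subseteq> edges T"
  by (auto simp: axis_edges_def shifts_def)

lemma separating_axis_edges:
  assumes H: "subgroup H G" and x: "x \<in> \<Union>(axis_edges H)" and y: "y \<in> \<Union>(axis_edges H)"
    and e: "e \<in> separating (edges T) x y"
  shows "e \<in> axis_edges H"
proof -
  obtain u v where uv: "e = {u, v}" "{u, v} \<in> edges T" "x \<notin> branch u v" "y \<in> branch u v"
    using e by (auto simp: separating_def)
  obtain a b h where ab: "x \<in> {a, b}" "h \<in> H" "shifts h a b"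
    using x by (auto simp: axis_edges_def)
  obtain c d k where cd: "y \<in> {c, d}" "k \<in> H" "shifts k c d"
    using y by (auto simp: axis_edges_def)
  show ?thesis
  proof (cases "{u, v} = {a, b} \<or> {u, v} = {c, d}")
    case True
    then show ?thesis
      using ab cd uv unfolding axis_edges_def by blast
  next
    case False
    then have "a \<notin> branch u v" "c \<in> branch u v"
      using ab cd uv side_edge[of a b "edges T" u v] side_edge[of c d "edges T" u v]
      by (auto simp: shifts_def)
    then show ?thesis
      using axis_edges_between[OF H ab(2,3) cd(2,3) uv(2)] False uv(1) by blast
  qed
qed

text \<open>Among all vertices take one whose arc to its image under \<open>h\<close> is shortest. This arc and
  its translate by \<open>h\<close>, which starts where the arc ends, do not backtrack there:
  otherwise the second vertex of the arc would have a shorter arc to its image, or \<open>h\<close>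
  would invert an edge. So \<open>h\<close> shifts the first edge of the arc.\<close>

lemma not_elliptic_imp_shifts:
  assumes h: "h \<in> carrier G" and "\<not> elliptic G T h"
  shows "\<exists>a b. shifts h a b"
proof -
  have no_fix: "act T h v \<noteq> v" if "v \<in> verts T" for v
    using assms that elliptic_iff by blast
  define arc where "arc n \<longleftrightarrow>
    (\<exists>xs. walk (verts T) (edges T) xs \<and> distinct xs \<and> last xs = act T h (hd xs) \<and> length xs = n)" for n
  obtain v where v: "v \<in> verts T"
    using nonempty by blast
  then obtain xs0 where "walk (verts T) (edges T) xs0" "distinct xs0" "hd xs0 = v" "last xs0 = act T h v"
    using path_exists[of v "act T h v"] h by auto
  then have "arc (length xs0)"
    by (auto simp: arc_def)
  then have "arc (LEAST n. arc n)"
    by (rule LeastI)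
  then obtain xs where xs: "walk (verts T) (edges T) xs" "distinct xs" "last xs = act T h (hd xs)"
      "length xs = (LEAST n. arc n)"
    by (auto simp: arc_def)
  define x0 where "x0 = hd xs"
  then have x0: "x0 = hd xs" "x0 \<in> verts T"
    using xs(1) by (auto simp: walk_def)
  let ?z = "act T h x0"
  have z: "?z \<noteq> x0"
    using no_fix x0 by blast
  obtain x1 zs where split1: "xs = x0 # x1 # zs"
    using xs x0 z by (cases xs rule: remdups_adj.cases) (auto simp: walk_def)
  have lastz: "last (x1 # zs) = ?z"
    using xs(3) x0(1) split1 by (metis last_ConsR list.distinct(1))
  obtain ys y where split2: "xs = ys @ [y, ?z]"
  proof -
    obtain us where us: "xs = us @ [?z]"
      using xs x0 by (metis append_butlast_last_id walk_def)
    then have "us \<noteq> []"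
      using split1 by auto
    then obtain ys y where "us = ys @ [y]"
      by (metis append_butlast_last_id)
    then show thesis
      using us that by simp
  qed
  have e0: "{x0, x1} \<in> edges T"
    using xs(1) split1 by (simp add: walk_def)
  have ez: "{y, ?z} \<in> edges T" "{?z, y} \<in> edges T"
    using xs(1) split2 by (simp_all add: walk_def successively_append_iff insert_commute)
  let ?w = "act T h x1"
  have verts: "x1 \<in> verts T" "?z \<in> verts T" "?w \<in> verts T"
    using edgeD[OF e0] h by auto
  have he: "{?z, ?w} \<in> edges T" "{?w, ?z} \<in> edges T"
    using act_edge[OF h e0] by (simp_all add: insert_commute)
  have zB: "?z \<in> branch x0 x1"
    using path_edges_separate(2)[of "[]" x0 x1 zs] xs(1,2)[unfolded split1] lastz by simp
  have "hd (ys @ [y, ?z]) = x0"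
    using split1 split2 by (metis list.sel(1))
  then have "hd (ys @ [y]) = x0"
    by (cases ys) simp_all
  moreover have "walk (verts T) (edges T) (ys @ y # ?z # [])" "distinct (ys @ y # ?z # [])"
    using xs(1,2)[unfolded split2] by simp_all
  ultimately have "x0 \<notin> branch y ?z"
    using path_edges_separate(1)[of ys y ?z "[]"] by simp
  then have x0z: "x0 \<in> branch ?z y"
    using mem_side_flip[OF ez(1)] x0(2) by blast
  \<comment> \<open>the arc and its translate do not backtrack where they meet\<close>
  have turn: "?w \<noteq> y"
  proof
    assume w: "?w = y"
    show False
    proof (cases zs)
      case Nil
      then show False
        using split1 split2 w no_inversion[OF h e0] by (cases ys) auto
    next
      case (Cons z' zs')
      then obtain ys' where ys': "ys = x0 # ys'" "ys' @ [y, ?z] = x1 # zs"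
        using split1 split2 by (cases ys) auto
      have hd: "hd (ys' @ [y]) = x1"
        using ys'(2) by (cases ys') auto
      have "walk (verts T) (edges T) (ys' @ [y])" "distinct (ys' @ [y])"
        using xs(1,2)[unfolded split2 ys'(1)]
        by (auto simp: walk_def successively_append_iff successively_Cons)
      moreover have "last (ys' @ [y]) = act T h (hd (ys' @ [y]))"
        using hd w by simp
      ultimately have "arc (length (ys' @ [y]))"
        unfolding arc_def by blast
      then show False
        using not_less_Least[of "length (ys' @ [y])" arc] xs(4)[unfolded split2] ys'(1) by simp
    qed
  qed
  have ne1: "{?z, y} \<noteq> {?w, ?z}"
    using turn edgeD[OF ez(1)] by (auto simp: doubleton_eq_iff)
  have ne2: "{?z, ?w} \<noteq> {x0, x1}"
    using z no_inversion[OF h e0] by (auto simp: doubleton_eq_iff)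
  have "?w \<notin> branch ?z y"
    using side_edge[OF he(2), of ?z y] ne1 origin_notin_side[OF ez(2)] by metis
  moreover have "y \<in> branch ?w ?z"
    using side_edge[OF ez(1), of ?w ?z] ne1 side_self[of ?z "edges T" ?w] by (simp add: insert_commute)
  ultimately have "branch ?z y \<subseteq> branch ?w ?z"
    using side_nested[OF ez(2) ne1 he(2)] by blast
  then have x0w: "x0 \<notin> branch ?z ?w"
    using x0z mem_side_flip[OF he(1), of x0] x0 by blast
  then have x1w: "x1 \<notin> branch ?z ?w"
    using side_edge[OF e0, of ?z ?w] ne2 by metis
  have "?w \<in> branch x0 x1"
    using side_edge[OF he(1) ne2] zB by blast
  then have "branch ?z ?w \<subseteq> branch x0 x1"
    using side_nested[OF he(1) ne2 e0 x0w] by blast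
  then have "shifts h x0 x1"
    using h e0 x1w side_self[of x1 "edges T" x0] by (auto simp: shifts_def act_branch)
  then show ?thesis
    by blast
qed

lemma edge_act_axis_edges:
  assumes "g \<in> carrier G" "e \<in> axis_edges H" "\<And>h. h \<in> H \<Longrightarrow> g \<otimes> h \<otimes> inv g \<in> K"
  shows "edge_act T g e \<in> axis_edges K"
proof -
  obtain a b h where "e = {a, b}" "h \<in> H" "shifts h a b"
    using assms(2) by (auto simp: axis_edges_def)
  then show ?thesis
    unfolding axis_edges_def using shifts_conj[of h a b g] assms(1,3) by auto
qed

lemma shifts_imp_not_elliptic: "shifts h a b \<Longrightarrow> \<not> elliptic G T h"
  using shifts_no_fixed_vertex[of h a b] elliptic_iff[of h] unfolding shifts_def by metis

lemma acts_nontrivially_iff: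
  assumes "subgroup H G"
  shows "acts_nontrivially G T H \<longleftrightarrow> axis_edges H \<noteq> {}"
proof
  assume "acts_nontrivially G T H"
  then obtain h where "h \<in> H" "\<not> elliptic G T h"
    by (auto simp: acts_nontrivially_def)
  then obtain a b where "shifts h a b"
    using not_elliptic_imp_shifts[OF subgroup.mem_carrier[OF assms]] by blast
  then have "{a, b} \<in> axis_edges H"
    using \<open>h \<in> H\<close> by (auto simp: axis_edges_def)
  then show "axis_edges H \<noteq> {}"
    by blast
next
  assume "axis_edges H \<noteq> {}"
  then show "acts_nontrivially G T H"
    using shifts_imp_not_elliptic by (auto simp: axis_edges_def acts_nontrivially_def)
qed

text \<open>Powers of the shifting element move a vertex of the subtree to both sides of the shifted edge.\<close>

lemma axis_edges_in_invariant_subtree: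
  assumes H: "subgroup H G" and W: "invariant_subtree T H W"
  shows "\<Union>(axis_edges H) \<subseteq> W"
proof
  fix x assume "x \<in> \<Union>(axis_edges H)"
  then obtain a b h where x: "x \<in> {a, b}" "h \<in> H" and sh: "shifts h a b"
    by (auto simp: axis_edges_def)
  have WV: "W \<subseteq> verts T" and Wt: "simplicial_tree W (sub_edges T W)"
    and inv: "\<And>h. h \<in> H \<Longrightarrow> act T h ` W = W"
    using W by (auto simp: invariant_subtree_def)
  obtain w where w: "w \<in> W" "w \<in> verts T"
    using Wt WV by (auto simp: simplicial_tree_def)
  have pow: "h [^] n \<in> H" "inv (h [^] n) \<in> H" for n :: nat
    using H x(2) by (induction n) (auto simp: subgroup.m_closed subgroup.one_closed subgroup.m_inv_closed)
  have "\<exists>n :: nat. act T (h [^] n) w \<in> branch a b"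
    using shifts_attract[OF sh w(2)] by (metis (mono_tags, lifting) UNIV_I UNIV_eq_I infinite_UNIV_nat mem_Collect_eq)
  then obtain u where u: "u \<in> W" "u \<in> branch a b"
    using inv[OF pow(1)] w(1) by blast
  have "\<exists>n :: nat. act T (inv (h [^] n)) w \<notin> branch a b"
    using shifts_escape[OF sh w(2)] by (metis (mono_tags, lifting) UNIV_I UNIV_eq_I infinite_UNIV_nat mem_Collect_eq)
  then obtain u' where u': "u' \<in> W" "u' \<notin> branch a b"
    using inv[OF pow(2)] w(1) by blast
  have "{a, b} \<in> separating (edges T) u' u"
    using u u' sh by (auto simp: separating_def shifts_def)
  then have "{a, b} \<subseteq> W"
    using subtree_imp_separating[OF Wt _ u'(1) u(1)] by (auto simp: sub_edges_def)
  then show "x \<in> W"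
    using x by blast
qed

lemma edge_in_axes:
  assumes H: "subgroup H G" and e: "e \<in> edges T" "e \<subseteq> \<Union>(axis_edges H)"
  shows "e \<in> axis_edges H"
proof -
  obtain a b where ab: "e = {a, b}"
    using e(1) by (rule edgeE)
  have "{a, b} \<in> separating (edges T) a b"
    using e(1) ab origin_notin_side[of a b] side_self[of b "edges T" a] by (auto simp: separating_def)
  then show ?thesis
    using separating_axis_edges[OF H, of a b] e(2) ab by simp
qed

lemma invariant_subtree_axes:
  assumes H: "subgroup H G" and ne: "axis_edges H \<noteq> {}"
  shows "invariant_subtree T H (\<Union>(axis_edges H))"
proof -
  let ?W = "\<Union>(axis_edges H)"
  have sub: "act T h ` ?W \<subseteq> ?W" if "h \<in> H" for h
  proof -
    have hc: "h \<in> carrier G"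
      using that subgroup.mem_carrier[OF H] by blast
    have "edge_act T h e \<in> axis_edges H" if "e \<in> axis_edges H" for e
      using edge_act_axis_edges[OF hc that, of H] \<open>h \<in> H\<close> H
      by (simp add: subgroup.m_closed subgroup.m_inv_closed)
    then show ?thesis
      unfolding edge_act_def by blast
  qed
  have WV: "?W \<subseteq> verts T"
    using axis_edges_subset edge_subset by blast
  have "act T h ` ?W = ?W" if "h \<in> H" for h
  proof
    show "?W \<subseteq> act T h ` ?W"
    proof
      fix x assume x: "x \<in> ?W"
      have "inv h \<in> H"
        using that H by (rule subgroup.m_inv_closed[rotated])
      then have "act T (inv h) x \<in> ?W"
        using sub x by blast
      moreover have "x = act T h (act T (inv h) x)"
        using x WV subgroup.mem_carrier[OF H that] by auto
      ultimately show "x \<in> act T h ` ?W"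
        by (rule image_eqI[rotated])
    qed
  qed (rule sub[OF that])
  moreover have "?W \<noteq> {}"
  proof -
    obtain e where e: "e \<in> axis_edges H"
      using ne by blast
    then have "e \<noteq> {}"
      by (auto simp: axis_edges_def)
    then show ?thesis
      using e by blast
  qed
  moreover have "simplicial_tree ?W {e \<in> edges T. e \<subseteq> ?W}"
    using WV \<open>?W \<noteq> {}\<close> separating_axis_edges[OF H] by (intro separating_imp_subtree) blast+
  ultimately show ?thesis
    unfolding invariant_subtree_def sub_edges_def using WV by blast
qed

lemma Min_tree_eq:
  assumes H: "subgroup H G" and ne: "axis_edges H \<noteq> {}"
  shows "Min_tree T H = \<Union>(axis_edges H)"
  unfolding Min_tree_def
proof (rule the_equality)
  show "invariant_subtree T H (\<Union>(axis_edges H)) \<and>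
      (\<forall>W'. invariant_subtree T H W' \<and> W' \<subseteq> \<Union>(axis_edges H) \<longrightarrow> W' = \<Union>(axis_edges H))"
    using invariant_subtree_axes[OF assms] axis_edges_in_invariant_subtree[OF H] by blast
next
  fix W
  assume W: "invariant_subtree T H W \<and> (\<forall>W'. invariant_subtree T H W' \<and> W' \<subseteq> W \<longrightarrow> W' = W)"
  then show "W = \<Union>(axis_edges H)"
    using invariant_subtree_axes[OF assms] axis_edges_in_invariant_subtree[OF H] by blast
qed

lemma sub_edges_axes: "subgroup H G \<Longrightarrow> sub_edges T (\<Union>(axis_edges H)) = axis_edges H"
  using edge_in_axes axis_edges_subset by (fastforce simp: sub_edges_def)

lemma Min_edges_eq:
  assumes H: "subgroup H G"
  shows "Min_edges G T H = axis_edges H"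
  using acts_nontrivially_iff[OF H] Min_tree_eq[OF H] sub_edges_axes[OF H]
  by (auto simp: Min_edges_def)

text \<open>The subtree is a fixed vertex if the group is elliptic, and the union of the axes otherwise.\<close>

lemma subtree_missing_edge:
  assumes H: "subgroup H G" and dich: "acts_nontrivially G T H \<or> has_fixed_point G T H"
    and e: "e \<in> edges T" "e \<notin> axis_edges H"
  obtains W where "invariant_subtree T H W" "\<not> e \<subseteq> W"
proof (cases "axis_edges H = {}")
  case True
  then obtain p where p: "p \<in> points T" "\<And>h. h \<in> H \<Longrightarrow> pt_act G T h p = p"
    using dich acts_nontrivially_iff[OF H] by (auto simp: has_fixed_point_def fixed_by_def)
  then obtain q where q: "q \<in> supp p" "q \<in> verts T"
    using supp_nonempty[OF p(1)] supp_subset_verts[OF tree_axioms p(1)] by blast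
  have "act T h q = q" if "h \<in> H" for h
    using fixed_point_fixes_supp[OF subgroup.mem_carrier[OF H that] p(1) p(2)[OF that] q(1)] .
  moreover have "simplicial_tree {q} {e \<in> edges T. e \<subseteq> {q}}"
    using q by (intro separating_imp_subtree) (auto simp: separating_def)
  ultimately have "invariant_subtree T H {q}"
    using q by (auto simp: invariant_subtree_def sub_edges_def)
  moreover have "\<not> e \<subseteq> {q}"
    using e(1) by (elim edgeE) auto
  ultimately show thesis
    by (rule that)
next
  case False
  then show thesis
    using that[OF invariant_subtree_axes[OF H]] edge_in_axes[OF H e(1)] e(2) by blast
qed

section \<open>Edge stabilizers and their cosets\<close>

lemma edge_stab_iff: "g \<in> edge_stab G T e \<longleftrightarrow> g \<in> carrier G \<and> edge_act T g e = e"
  by (simp add: stabilizer_def)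

lemma subgroup_edge_stab:
  assumes "e \<in> edges T"
  shows "subgroup (edge_stab G T e) G"
proof (rule subgroupI)
  show "edge_stab G T e \<noteq> {}"
    using edge_act_one[OF assms] edge_stab_iff by blast
  show "inv g \<in> edge_stab G T e" if "g \<in> edge_stab G T e" for g
    using that edge_act_inv_act[of g e] assms by (simp add: edge_stab_iff)
  show "g \<otimes> h \<in> edge_stab G T e" if "g \<in> edge_stab G T e" "h \<in> edge_stab G T e" for g h
    using that edge_act_mult[of g h e] assms by (simp add: edge_stab_iff)
qed (auto simp: edge_stab_iff)

lemma edge_stab_conj:
  assumes "g \<in> carrier G" "e \<in> edges T" "h \<in> edge_stab G T e"
  shows "g \<otimes> h \<otimes> inv g \<in> edge_stab G T (edge_act T g e)"
  using assms edge_act_mult[of "g \<otimes> h" "inv g" "edge_act T g e"] edge_act_mult[of g h e]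
    edge_act_inv_act[of g e] edge_act_closed[of g e]
  by (simp add: edge_stab_iff)

lemma edge_stab_fixes_ends:
  assumes "{a, b} \<in> edges T" "h \<in> edge_stab G T {a, b}"
  shows "act T h a = a" "act T h b = b"
  using assms no_inversion[of h a b] by (auto simp: edge_stab_iff doubleton_eq_iff)

text \<open>This identifies the cosets of the stabilizer of \<open>e\<close> with the translates of
  \<open>e\<close>, so that infinite sets of cosets become infinite sets of edges.\<close>

lemma coset_edge_stab_eq_iff:
  assumes e: "e \<in> edges T" and g: "g \<in> carrier G" "g' \<in> carrier G"
  shows "edge_stab G T e #> g = edge_stab G T e #> g' \<longleftrightarrow> edge_act T (inv g) e = edge_act T (inv g') e"
proof
  assume "edge_stab G T e #> g = edge_stab G T e #> g'"
  then have "g \<in> edge_stab G T e #> g'"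
    using rcos_self[OF g(1) subgroup_edge_stab[OF e]] by simp
  then obtain h where h: "h \<in> edge_stab G T e" "g = h \<otimes> g'"
    by (auto simp: r_coset_def)
  then have "edge_act T (inv g) e = edge_act T (inv g') (edge_act T (inv h) e)"
    using g e by (simp add: edge_stab_iff inv_mult_group edge_act_mult)
  then show "edge_act T (inv g) e = edge_act T (inv g') e"
    using h edge_act_inv_act[of h e] e by (simp add: edge_stab_iff)
next
  assume eq: "edge_act T (inv g) e = edge_act T (inv g') e"
  have "edge_act T (g \<otimes> inv g') e = e"
    using g e edge_act_mult[of g "inv g'" e] edge_act_act_inv[of g e] eq by simp
  then have "g \<otimes> inv g' \<in> edge_stab G T e"
    using g by (simp add: edge_stab_iff)
  moreover have "g = (g \<otimes> inv g') \<otimes> g'"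
    using g by (simp add: m_assoc)
  ultimately have "g \<in> edge_stab G T e #> g'"
    by (auto simp: r_coset_def)
  then show "edge_stab G T e #> g = edge_stab G T e #> g'"
    using repr_independence[OF _ g(2) subgroup_edge_stab[OF e]] by simp
qed

lemma finite_cosets_iff:
  assumes "e \<in> edges T" "A \<subseteq> carrier G"
  shows "finite ((\<lambda>g. edge_stab G T e #> g) ` A) \<longleftrightarrow> finite ((\<lambda>g. edge_act T (inv g) e) ` A)"
  using coset_edge_stab_eq_iff[OF assms(1)] assms(2)
  by (intro iffI; elim finite_image_kernel) auto

end

section \<open>Boundaries of half sets\<close>

lemma (in tree_action) half_set_eq:
  assumes p: "p \<in> points T" and e: "{a, b} \<in> edges T"
  shows "half_set G T p (a, b) = {g \<in> carrier G. \<exists>q\<in>supp p. act T g q \<in> branch a b}"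
  unfolding half_set_def half_tree_eq[OF tree_axioms e]
  using pt_act_closed[OF _ p] supp_pt_act[OF _ p] by auto

locale splitting_action = tree_action +
  assumes edges_nonempty: "edges T \<noteq> {}"
    and edges_transitive: "e \<in> edges T \<Longrightarrow> e' \<in> edges T \<Longrightarrow> \<exists>g\<in>carrier G. edge_act T g e = e'"
    and no_global_fixed_vertex: "v \<in> verts T \<Longrightarrow> \<exists>g\<in>carrier G. act T g v \<noteq> v"
begin

lemma vertex_in_edge:
  assumes "v \<in> verts T"
  shows "\<exists>w. {v, w} \<in> edges T"
proof -
  obtain x y where xy: "{x, y} \<in> edges T"
    using edges_nonempty edgeE by (metis ex_in_conv)
  show ?thesis
  proof (cases "v = x")
    case False
    obtain xs where xs: "walk (verts T) (edges T) xs" "hd xs = v" "last xs = x"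
      using path_exists[OF assms edgeD(1)[OF xy]] by metis
    then obtain w zs where "xs = v # w # zs"
      using False by (cases xs rule: remdups_adj.cases) (auto simp: walk_def)
    then show ?thesis
      using xs(1) by (auto simp: walk_def)
  qed (use xy in auto)
qed

text \<open>Suppose that \<open>b\<close> is the only neighbour of \<open>a\<close>. An element that moves
  \<open>a\<close> to \<open>b\<close> would move \<open>b\<close> to the only neighbour of
  \<open>b\<close>, which is \<open>a\<close>, and so invert \<open>{a, b}\<close>; hence there is
  none. Then every edge at \<open>b\<close> leads to a translate of \<open>a\<close>, that is to a
  leaf; the tree is a star with centre \<open>b\<close>, which is a global fixed point.\<close>

lemma second_neighbour:
  assumes e: "{a, b} \<in> edges T"
  obtains c where "{a, c} \<in> edges T" "c \<noteq> b"
proof (rule ccontr)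
  assume "\<not> thesis"
  then have leaf: "c = b" if "{a, c} \<in> edges T" for c
    using that \<open>\<And>c. {a, c} \<in> edges T \<Longrightarrow> c \<noteq> b \<Longrightarrow> thesis\<close> by blast
  have ab: "a \<in> verts T" "b \<in> verts T"
    using edgeD[OF e] by auto
  have leaf': "c = act T g b" if g: "g \<in> carrier G" and c: "{act T g a, c} \<in> edges T" for g c
  proof -
    have "{a, act T (inv g) c} \<in> edges T"
      using act_edge[OF inv_closed[OF g] c] g ab by simp
    then have "act T (inv g) c = b"
      by (rule leaf)
    then show ?thesis
      using act_eq_swap[of "inv g" c b] g edgeD[OF c] ab by simp
  qed
  have not_swapped: "act T g a \<noteq> b" if g: "g \<in> carrier G" for g
  proof
    assume ga: "act T g a = b"
    then have "a = act T g b"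
      using leaf'[OF g, of a] e by (simp add: insert_commute)
    then show False
      using no_inversion[OF g e ga] by simp
  qed
  have "act T g b = b" if g: "g \<in> carrier G" for g
  proof (rule ccontr)
    assume ne: "act T g b \<noteq> b"
    obtain xs where xs: "walk (verts T) (edges T) xs" "distinct xs" "hd xs = b" "last xs = act T g b"
      using path_exists[of b "act T g b"] ab g by auto
    obtain x zs where split: "xs = b # x # zs"
      using xs ne by (cases xs rule: remdups_adj.cases) (auto simp: walk_def)
    have bx: "{b, x} \<in> edges T"
      using xs(1) split by (simp add: walk_def)
    obtain k where k: "k \<in> carrier G" "edge_act T k {a, b} = {b, x}"
      using edges_transitive[OF e bx] by blast
    then have kx: "act T k a = x" "act T k b = b"
      using not_swapped[OF k(1)] by (auto simp: doubleton_eq_iff)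
    show False
    proof (cases zs)
      case Nil
      then have "act T g b = act T k a"
        using xs(4) split kx by simp
      then have "act T (inv k \<otimes> g) b = a"
        using k(1) g ab by (simp add: act_mult)
      then have "act T (inv (inv k \<otimes> g)) a = b"
        using act_inv_act[of "inv k \<otimes> g" b] k(1) g ab by simp
      then show False
        using not_swapped[of "inv (inv k \<otimes> g)"] k(1) g by simp
    next
      case (Cons z zs')
      then have "{act T k a, z} \<in> edges T"
        using xs(1) split kx by (simp add: walk_def)
      then have "z = b"
        using leaf'[OF k(1)] kx by simp
      then show False
        using xs(2) split Cons by simp
    qed
  qed
  then show False
    using no_global_fixed_vertex[OF ab(2)] by blast
qed

lemma point_carried_into_branch:
  assumes p: "p \<in> points T" and e: "{a, b} \<in> edges T"
  shows "\<exists>g\<in>carrier G. act T g ` supp p \<subseteq> branch a b"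
proof -
  have e': "{b, a} \<in> edges T"
    using e by (simp add: insert_commute)
  obtain c where c: "{b, c} \<in> edges T" "c \<noteq> a"
    using second_neighbour[OF e'] .
  have "{b, c} \<noteq> {a, b}"
    using c edgeD[OF e] by (auto simp: doubleton_eq_iff)
  then have cB: "{b, c} \<subseteq> branch a b"
    using side_edge[OF c(1)] side_self[of b "edges T" a] by auto
  obtain d where d: "d \<in> edges T" "supp p \<subseteq> d"
    using p vertex_in_edge by (fastforce simp: in_points_iff)
  obtain g where "g \<in> carrier G" "edge_act T g d = {b, c}"
    using edges_transitive[OF d(1) c(1)] by blast
  then show ?thesis
    using d(2) cB unfolding edge_act_def by blast
qed

lemma half_set_left_mult:
  assumes p: "p \<in> points T" and e: "{a, b} \<in> edges T" and h: "h \<in> edge_stab G T {a, b}" and g: "g \<in> carrier G"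
  shows "h \<otimes> g \<in> half_set G T p (a, b) \<longleftrightarrow> g \<in> half_set G T p (a, b)"
proof -
  have hc: "h \<in> carrier G"
    using h by (simp add: edge_stab_iff)
  have "act T (h \<otimes> g) q \<in> branch a b \<longleftrightarrow> act T g q \<in> branch a b" if "q \<in> supp p" for q
  proof -
    have "q \<in> verts T"
      using that supp_subset_verts[OF tree_axioms p] by blast
    then show ?thesis
      using act_mem_branch_iff[OF hc e, of "act T g q"] edge_stab_fixes_ends[OF e h] g hc
      by (simp add: act_mult)
  qed
  then show ?thesis
    using g hc by (simp add: half_set_eq[OF p e])
qed

lemma boundary_left_mult:
  assumes p: "p \<in> points T" and e: "{a, b} \<in> edges T" and h: "h \<in> edge_stab G T {a, b}" and S: "S \<subseteq> carrier G"
    and g: "g \<in> cayley_boundary G S (half_set G T p (a, b))"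
  shows "h \<otimes> g \<in> cayley_boundary G S (half_set G T p (a, b))"
proof -
  obtain s where s: "s \<in> S \<union> m_inv G ` S" "g \<otimes> s \<notin> half_set G T p (a, b)" and gX: "g \<in> half_set G T p (a, b)"
    using g by (auto simp: cayley_boundary_def)
  have c: "g \<in> carrier G" "s \<in> carrier G" "h \<in> carrier G"
    using gX s S h by (auto simp: half_set_def edge_stab_iff)
  have "h \<otimes> g \<otimes> s \<notin> half_set G T p (a, b)"
    using half_set_left_mult[OF p e h, of "g \<otimes> s"] s c by (simp add: m_assoc)
  then show ?thesis
    using half_set_left_mult[OF p e h c(1)] gX s(1) unfolding cayley_boundary_def by blast
qed

text \<open>A half set without boundary would be closed under right multiplication by generators, hence be empty
  or the whole group; but it contains an element, and so does its complement.\<close>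

lemma boundary_nonempty:
  assumes p: "p \<in> points T" and e: "{a, b} \<in> edges T" and S: "S \<subseteq> carrier G" "generate G S = carrier G"
  shows "cayley_boundary G S (half_set G T p (a, b)) \<noteq> {}"
proof
  let ?X = "half_set G T p (a, b)"
  have e': "{b, a} \<in> edges T"
    using e by (simp add: insert_commute)
  assume "cayley_boundary G S ?X = {}"
  then have closed: "g \<otimes> s \<in> ?X" if "g \<in> ?X" "s \<in> S \<union> m_inv G ` S" for g s
    using that by (auto simp: cayley_boundary_def)
  have XG: "?X \<subseteq> carrier G"
    by (auto simp: half_set_def)
  have gen: "\<forall>g\<in>?X. g \<otimes> z \<in> ?X" if "z \<in> generate G S" for z
    using that
  proof (induction rule: generate.induct)
    case (eng z1 z2)
    have "g \<otimes> (z1 \<otimes> z2) \<in> ?X" if "g \<in> ?X" for g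
    proof -
      have "g \<otimes> z1 \<otimes> z2 \<in> ?X"
        using eng.IH that by blast
      then show ?thesis
        using that XG eng.hyps S(2) by (metis m_assoc subsetD)
    qed
    then show ?case
      by blast
  qed (use closed XG in \<open>auto simp: subset_iff\<close>)
  obtain g where g: "g \<in> carrier G" "act T g ` supp p \<subseteq> branch a b"
    using point_carried_into_branch[OF p e] by blast
  obtain k where k: "k \<in> carrier G" "act T k ` supp p \<subseteq> branch b a"
    using point_carried_into_branch[OF p e'] by blast
  have "g \<in> ?X"
    using g supp_nonempty[OF p] by (auto simp: half_set_eq[OF p e])
  then have "g \<otimes> (inv g \<otimes> k) \<in> ?X"
    using gen[of "inv g \<otimes> k"] g k S(2) by simp
  moreover have "g \<otimes> (inv g \<otimes> k) = k"
    using g(1) k(1) by (simp add: m_assoc[symmetric])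
  ultimately obtain q where "q \<in> supp p" "act T k q \<in> branch a b"
    by (auto simp: half_set_eq[OF p e])
  then show False
    using k(2) side_flip[OF e] by blast
qed

text \<open>If \<open>g\<close> is in the boundary, then \<open>g q\<close> and \<open>g s q\<close> are on
  different sides of \<open>{a, b}\<close> for a vertex \<open>q\<close> of the cell of the base
  point and a generator \<open>s\<close> (or its inverse), so
  \<open>g\<^sup>-\<^sup>1 {a, b}\<close> separates \<open>q\<close> from \<open>s q\<close>.\<close>

lemma finite_boundary:
  assumes p: "p \<in> points T" and e: "{a, b} \<in> edges T" and S: "S \<subseteq> carrier G" "finite S"
  shows "finite ((\<lambda>g. edge_act T (inv g) {a, b}) ` cayley_boundary G S (half_set G T p (a, b)))"
proof (rule finite_subset)
  let ?S = "S \<union> m_inv G ` S"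
  have SG: "?S \<subseteq> carrier G"
    using S by auto
  note sub = supp_subset_verts[OF tree_axioms p]
  show "finite (\<Union>q\<in>supp p. \<Union>s\<in>?S. separating (edges T) (act T s q) q)"
    using finite_supp[OF tree_axioms p] S(2) sub SG
    by (intro finite_UN_I finite_separating act_closed finite_UnI finite_imageI) blast+
  show "(\<lambda>g. edge_act T (inv g) {a, b}) ` cayley_boundary G S (half_set G T p (a, b))
      \<subseteq> (\<Union>q\<in>supp p. \<Union>s\<in>?S. separating (edges T) (act T s q) q)"
  proof (intro image_subsetI)
    fix g assume "g \<in> cayley_boundary G S (half_set G T p (a, b))"
    then obtain s where s: "s \<in> ?S" and gs: "g \<otimes> s \<notin> half_set G T p (a, b)" and gX: "g \<in> half_set G T p (a, b)"
      by (auto simp: cayley_boundary_def)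
    then obtain q where q: "q \<in> supp p" "act T g q \<in> branch a b" and g: "g \<in> carrier G"
      by (auto simp: half_set_eq[OF p e])
    have sc: "s \<in> carrier G" and qv: "q \<in> verts T"
      using s SG q sub by auto
    have "act T g (act T s q) \<notin> branch a b"
      using gs q g sc qv by (auto simp: half_set_eq[OF p e] act_mult)
    then have "{a, b} \<in> separating (edges T) (act T g (act T s q)) (act T g q)"
      using q e by (auto simp: separating_def)
    then have "edge_act T (inv g) {a, b} \<in> separating (edges T) (act T s q) q"
      using act_separating[of "inv g" "act T g (act T s q)" "act T g q" "{a, b}"] g sc qv by simp
    then show "edge_act T (inv g) {a, b} \<in> (\<Union>q\<in>supp p. \<Union>s\<in>?S. separating (edges T) (act T s q) q)"
      using q s by blast
  qed
qed

end

section \<open>Strong crossing\<close>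

locale splitting_pair = t1: splitting_action G T1 + t2: splitting_action G T2
  for G :: "('a, 'b) monoid_scheme" (structure) and T1 :: "('a, 'v) gtree" and T2 :: "('a, 'w) gtree"
begin

text \<open>With finitely many representatives \<open>f\<close> one writes \<open>g = h f\<close>,
  \<open>h\<close> in the stabilizer of \<open>e1\<close>. For \<open>w\<close> in \<open>W\<close>
  the edge \<open>{x, y}\<close> separates \<open>h w\<close>, which is again in \<open>W\<close>,
  from \<open>h f q\<close>; so \<open>h\<^sup>-\<^sup>1 {x, y}\<close> is one of the finitely many
  edges that separate \<open>w\<close> from \<open>f q\<close>.\<close>

lemma finite_cosets_beyond_edge:
  assumes e1: "e1 \<in> edges T1" and A: "A \<subseteq> carrier G" "finite ((\<lambda>g. edge_act T1 (inv g) e1) ` A)"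
    and W: "invariant_subtree T2 (edge_stab G T1 e1) W" and e: "{x, y} \<in> edges T2" "W \<inter> t2.branch x y = {}"
    and Q: "finite Q" "Q \<subseteq> verts T2"
  shows "finite ((\<lambda>g. edge_act T2 (inv g) {x, y}) ` {g \<in> A. \<exists>q\<in>Q. act T2 g q \<in> t2.branch x y})"
proof -
  define F where "F = (\<lambda>g. edge_act T1 (inv g) e1) ` A"
  define r where "r = inv_into A (\<lambda>g. edge_act T1 (inv g) e1)"
  have r: "r \<epsilon> \<in> A" "edge_act T1 (inv (r \<epsilon>)) e1 = \<epsilon>" if "\<epsilon> \<in> F" for \<epsilon>
    using that inv_into_into[of \<epsilon> "\<lambda>g. edge_act T1 (inv g) e1" A]
      f_inv_into_f[of \<epsilon> "\<lambda>g. edge_act T1 (inv g) e1" A] unfolding F_def r_def by auto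
  have WV: "W \<subseteq> verts T2" and Wne: "W \<noteq> {}" and inv: "\<And>h. h \<in> edge_stab G T1 e1 \<Longrightarrow> act T2 h ` W = W"
    using W by (auto simp: invariant_subtree_def simplicial_tree_def)
  obtain w where w: "w \<in> W" "w \<in> verts T2"
    using WV Wne by blast
  let ?U = "\<Union>\<epsilon>\<in>F. \<Union>q\<in>Q. edge_act T2 (inv (r \<epsilon>)) ` separating (edges T2) w (act T2 (r \<epsilon>) q)"
  have "finite ?U"
    using A Q w r(1) unfolding F_def[symmetric]
    by (intro finite_UN_I finite_imageI t2.finite_separating) (auto intro!: t2.act_closed)
  moreover have "(\<lambda>g. edge_act T2 (inv g) {x, y}) ` {g \<in> A. \<exists>q\<in>Q. act T2 g q \<in> t2.branch x y} \<subseteq> ?U"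
  proof (intro image_subsetI)
    fix g assume "g \<in> {g \<in> A. \<exists>q\<in>Q. act T2 g q \<in> t2.branch x y}"
    then obtain q where g: "g \<in> A" "g \<in> carrier G" and q: "q \<in> Q" "q \<in> verts T2" "act T2 g q \<in> t2.branch x y"
      using A Q by blast
    define \<epsilon> where "\<epsilon> = edge_act T1 (inv g) e1"
    have \<epsilon>: "\<epsilon> \<in> F"
      using g by (simp add: F_def \<epsilon>_def)
    define f where "f = r \<epsilon>"
    have f: "f \<in> carrier G" "edge_act T1 (inv f) e1 = \<epsilon>"
      using r[OF \<epsilon>] A by (auto simp: f_def)
    define h where "h = g \<otimes> inv f"
    have hc: "h \<in> carrier G"
      using f g by (simp add: h_def)
    have "edge_act T1 h e1 = e1"
      using f(1) g(2) e1 t1.edge_act_mult[of g "inv f" e1] f(2) t1.edge_act_act_inv[of g e1]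
      by (simp add: h_def \<epsilon>_def)
    then have hK: "h \<in> edge_stab G T1 e1"
      using hc by (simp add: t1.edge_stab_iff)
    have ghf: "g = h \<otimes> f"
      using f g by (simp add: h_def t1.m_assoc)
    have "act T2 h w \<in> W"
      using inv[OF hK] w by blast
    then have "{x, y} \<in> separating (edges T2) (act T2 h w) (act T2 h (act T2 f q))"
      using e q f(1) hc by (auto simp: separating_def ghf t2.act_mult)
    then have "edge_act T2 (inv h) {x, y} \<in> separating (edges T2) w (act T2 f q)"
      using t2.act_separating[of "inv h" "act T2 h w" "act T2 h (act T2 f q)" "{x, y}"] hc f(1) q w
      by simp
    moreover have "edge_act T2 (inv g) {x, y} = edge_act T2 (inv f) (edge_act T2 (inv h) {x, y})"
      using hc f(1) e(1) t2.edge_act_mult[of "inv f" "inv h" "{x, y}"] by (simp add: ghf t1.inv_mult_group)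
    ultimately show "edge_act T2 (inv g) {x, y} \<in> ?U"
      using \<epsilon> q(1) unfolding f_def by blast
  qed
  ultimately show ?thesis
    by (rule finite_subset[rotated])
qed

text \<open>The elements \<open>h\<^sup>n f\<close> stay in \<open>A\<close>, move \<open>Q\<close> beyond
  \<open>{x, y}\<close> for all large \<open>n\<close>, and have pairwise different cosets because
  the edges \<open>h\<^sup>-\<^sup>n {x, y}\<close> are pairwise different.\<close>

lemma infinite_cosets_along_axis:
  assumes A: "\<And>h g. h \<in> K \<Longrightarrow> g \<in> A \<Longrightarrow> h \<otimes> g \<in> A" "f \<in> A" "A \<subseteq> carrier G" and K: "subgroup K G"
    and sh: "h \<in> K" "t2.shifts h x y" and Q: "finite Q" "Q \<subseteq> verts T2"
  shows "infinite ((\<lambda>g. edge_act T2 (inv g) {x, y}) ` {g \<in> A. act T2 g ` Q \<subseteq> t2.branch x y})"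
proof
  assume fin: "finite ((\<lambda>g. edge_act T2 (inv g) {x, y}) ` {g \<in> A. act T2 g ` Q \<subseteq> t2.branch x y})"
  have hc: "h \<in> carrier G" and e: "{x, y} \<in> edges T2"
    using sh by (auto simp: t2.shifts_def)
  have f: "f \<in> carrier G"
    using A by blast
  have pow: "h [^] n \<in> K" for n :: nat
    using K sh(1) by (induction n) (auto simp: subgroup.m_closed subgroup.one_closed)
  define N where "N = {n :: nat. act T2 (h [^] n \<otimes> f) ` Q \<subseteq> t2.branch x y}"
  have "- N \<subseteq> (\<Union>q\<in>Q. {n :: nat. act T2 (h [^] n) (act T2 f q) \<notin> t2.branch x y})"
    using Q hc f by (auto simp: N_def t2.act_mult subset_iff)
  moreover have "finite (\<Union>q\<in>Q. {n :: nat. act T2 (h [^] n) (act T2 f q) \<notin> t2.branch x y})"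
    using Q f by (intro finite_UN_I t2.shifts_attract[OF sh(2)]) auto
  ultimately have "finite (- N)"
    by (rule finite_subset)
  then have "infinite N"
    using infinite_UNIV_nat by (metis Compl_partition finite_Un)
  moreover have "finite N"
  proof (rule finite_imageD)
    let ?i = "\<lambda>n :: nat. edge_act T2 (inv (h [^] n \<otimes> f)) {x, y}"
    have "?i ` N \<subseteq> (\<lambda>g. edge_act T2 (inv g) {x, y}) ` {g \<in> A. act T2 g ` Q \<subseteq> t2.branch x y}"
    proof (intro image_subsetI)
      fix n assume "n \<in> N"
      then have "h [^] n \<otimes> f \<in> {g \<in> A. act T2 g ` Q \<subseteq> t2.branch x y}"
        using A(1)[OF pow A(2)] by (simp add: N_def)
      then show "?i n \<in> (\<lambda>g. edge_act T2 (inv g) {x, y}) ` {g \<in> A. act T2 g ` Q \<subseteq> t2.branch x y}"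
        by (rule imageI)
    qed
    then show "finite (?i ` N)"
      using fin by (rule finite_subset)
    have i: "?i n = edge_act T2 (inv f) (edge_act T2 ((inv h) [^] n) {y, x})" for n :: nat
      using hc f e t2.edge_act_mult[of "inv f" "inv (h [^] n)" "{x, y}"]
      by (simp add: t1.inv_mult_group t1.nat_pow_inv insert_commute)
    have closed: "edge_act T2 ((inv h) [^] n) {y, x} \<in> edges T2" for n :: nat
      using t2.edge_act_closed[of "(inv h) [^] n" "{y, x}"] hc e by (simp add: insert_commute)
    show "inj_on ?i N"
    proof (rule inj_onI)
      fix m n assume "?i m = ?i n"
      then have "edge_act T2 ((inv h) [^] m) {y, x} = edge_act T2 ((inv h) [^] n) {y, x}"
        unfolding i using t2.edge_act_inv_act[of "inv f"] closed f by (metis t1.inv_closed)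
      then show "m = n"
        using t2.inj_shifted_edges[OF t2.shifts_flip[OF sh(2)]] by (auto dest: injD)
    qed
  qed
  ultimately show False
    by blast
qed

text \<open>For an edge on an axis, \<open>infinite_cosets_along_axis\<close> is applied to the shifting element
  for one side and to its inverse for the other. For any other edge an invariant subtree lies on one
  side of it, and \<open>finite_cosets_beyond_edge\<close> applies to the opposite side.\<close>

lemma crosses_strongly_iff:
  assumes e1: "{a, b} \<in> edges T1" and e2: "{c, d} \<in> edges T2"
    and p1: "p1 \<in> points T1" and p2: "p2 \<in> points T2"
    and S: "finite S" "S \<subseteq> carrier G" "generate G S = carrier G"
    and dich: "acts_nontrivially G T2 (edge_stab G T1 {a, b}) \<or> has_fixed_point G T2 (edge_stab G T1 {a, b})"
  shows "crosses_strongly G S (half_set G T1 p1 (a, b)) (edge_stab G T2 {c, d}) (half_set G T2 p2 (c, d))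
    \<longleftrightarrow> {c, d} \<in> Min_edges G T2 (edge_stab G T1 {a, b})"
proof -
  let ?K = "edge_stab G T1 {a, b}"
  define A where "A = cayley_boundary G S (half_set G T1 p1 (a, b))"
  define Y where "Y = half_set G T2 p2 (c, d)"
  define \<phi> where "\<phi> g = edge_act T2 (inv g) {c, d}" for g
  have K: "subgroup ?K G"
    using t1.subgroup_edge_stab[OF e1] .
  have e2': "{d, c} \<in> edges T2"
    using e2 by (simp add: insert_commute)
  have AG: "A \<subseteq> carrier G"
    by (auto simp: A_def cayley_boundary_def half_set_def)
  note Q = finite_supp[OF t2.tree_axioms p2] supp_subset_verts[OF t2.tree_axioms p2]
  note Qne = supp_nonempty[OF p2]
  have Y_iff: "g \<in> Y \<longleftrightarrow> (\<exists>q\<in>supp p2. act T2 g q \<in> t2.branch c d)" if "g \<in> A" for g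
    using that AG by (auto simp: Y_def t2.half_set_eq[OF p2 e2])
  have flip: "act T2 g q \<in> t2.branch d c \<longleftrightarrow> act T2 g q \<notin> t2.branch c d" if "g \<in> A" "q \<in> supp p2" for g q
    using t2.mem_side_flip[OF e2] that AG Q t2.act_closed by blast
  have crosses: "crosses_strongly G S (half_set G T1 p1 (a, b)) (edge_stab G T2 {c, d}) Y \<longleftrightarrow>
      infinite (\<phi> ` (A \<inter> Y)) \<and> infinite (\<phi> ` (A \<inter> (carrier G - Y)))"
    unfolding crosses_strongly_def A_def[symmetric] \<phi>_def
    using t2.finite_cosets_iff[OF e2, of "A \<inter> Y"] t2.finite_cosets_iff[OF e2, of "A \<inter> (carrier G - Y)"] AG
    by blast
  have "infinite (\<phi> ` (A \<inter> Y)) \<and> infinite (\<phi> ` (A \<inter> (carrier G - Y)))"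
    if axis: "{c, d} \<in> t2.axis_edges ?K"
  proof -
    obtain h where h: "h \<in> ?K" "t2.shifts h c d"
    proof -
      obtain x y k where k: "{c, d} = {x, y}" "k \<in> ?K" "t2.shifts k x y"
        using axis by (auto simp: t2.axis_edges_def)
      then consider "t2.shifts k c d" | "t2.shifts k d c"
        by (auto simp: doubleton_eq_iff)
      then show thesis
        using that k(2) t2.shifts_flip[of k d c] subgroup.m_inv_closed[OF K k(2)] by cases blast+
    qed
    have mult: "k \<otimes> g \<in> A" if "k \<in> ?K" "g \<in> A" for k g
      using t1.boundary_left_mult[OF p1 e1 that(1) S(2)] that(2) by (simp add: A_def)
    obtain f where f: "f \<in> A"
      using t1.boundary_nonempty[OF p1 e1 S(2,3)] by (auto simp: A_def)
    have "infinite (\<phi> ` {g \<in> A. act T2 g ` supp p2 \<subseteq> t2.branch c d})"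
      unfolding \<phi>_def using infinite_cosets_along_axis[OF mult f AG K h Q] by blast
    moreover have "{g \<in> A. act T2 g ` supp p2 \<subseteq> t2.branch c d} \<subseteq> A \<inter> Y"
      using Y_iff Qne by blast
    ultimately have 1: "infinite (\<phi> ` (A \<inter> Y))"
      by (meson finite_subset image_mono)
    have "infinite (\<phi> ` {g \<in> A. act T2 g ` supp p2 \<subseteq> t2.branch d c})"
      using infinite_cosets_along_axis[OF mult f AG K subgroup.m_inv_closed[OF K h(1)] t2.shifts_flip[OF h(2)] Q]
      by (simp add: \<phi>_def insert_commute)
    moreover have "{g \<in> A. act T2 g ` supp p2 \<subseteq> t2.branch d c} \<subseteq> A \<inter> (carrier G - Y)"
      using Y_iff flip AG by blast
    ultimately have "infinite (\<phi> ` (A \<inter> (carrier G - Y)))"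
      by (meson finite_subset image_mono)
    with 1 show ?thesis
      by blast
  qed
  moreover have "finite (\<phi> ` (A \<inter> Y)) \<or> finite (\<phi> ` (A \<inter> (carrier G - Y)))"
    if off: "{c, d} \<notin> t2.axis_edges ?K"
  proof -
    obtain W where W: "invariant_subtree T2 ?K W" "\<not> {c, d} \<subseteq> W"
      using t2.subtree_missing_edge[OF K dich e2 off] .
    have finA: "finite ((\<lambda>g. edge_act T1 (inv g) {a, b}) ` A)"
      unfolding A_def using t1.finite_boundary[OF p1 e1 S(2,1)] .
    have "W \<inter> t2.branch c d = {} \<or> W \<inter> t2.branch d c = {}"
    proof (rule ccontr)
      assume "\<not> ?thesis"
      then obtain x y where xy: "x \<in> W" "x \<in> t2.branch c d" "y \<in> W" "y \<in> t2.branch d c"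
        by blast
      then have "{c, d} \<in> separating (edges T2) y x"
        using e2 t2.side_flip[OF e2] by (auto simp: separating_def)
      then have "{c, d} \<subseteq> W"
        using t2.subtree_imp_separating[of W "sub_edges T2 W" y x] W(1) xy
        by (auto simp: invariant_subtree_def sub_edges_def)
      then show False
        using W(2) by blast
    qed
    then show ?thesis
    proof
      assume "W \<inter> t2.branch c d = {}"
      then have "finite (\<phi> ` {g \<in> A. \<exists>q\<in>supp p2. act T2 g q \<in> t2.branch c d})"
        unfolding \<phi>_def using finite_cosets_beyond_edge[OF e1 AG finA W(1) e2 _ Q] by blast
      moreover have "A \<inter> Y \<subseteq> {g \<in> A. \<exists>q\<in>supp p2. act T2 g q \<in> t2.branch c d}"
        using Y_iff by blast
      ultimately show ?thesis
        by (meson finite_subset image_mono)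
    next
      assume "W \<inter> t2.branch d c = {}"
      then have "finite (\<phi> ` {g \<in> A. \<exists>q\<in>supp p2. act T2 g q \<in> t2.branch d c})"
        using finite_cosets_beyond_edge[OF e1 AG finA W(1) e2' _ Q] by (simp add: \<phi>_def insert_commute)
      moreover have "A \<inter> (carrier G - Y) \<subseteq> {g \<in> A. \<exists>q\<in>supp p2. act T2 g q \<in> t2.branch d c}"
        using Y_iff flip Qne by blast
      ultimately show ?thesis
        by (meson finite_subset image_mono)
    qed
  qed
  ultimately show ?thesis
    using crosses unfolding t2.Min_edges_eq[OF K] Y_def by blast
qed

end

section \<open>Distances from a point to the points of an edge\<close>

lemma (in tree) vdist_pos:
  assumes "u \<in> V" "v \<in> V" "u \<noteq> v"
  shows "1 \<le> vdist V E u v"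
proof -
  let ?P = "\<lambda>n. \<exists>xs. walk V E xs \<and> hd xs = u \<and> last xs = v \<and> length xs = Suc n"
  obtain xs where xs: "walk V E xs" "hd xs = u" "last xs = v"
    using path_exists[OF assms(1,2)] by metis
  then have "?P (length xs - 1)"
    by (intro exI[of _ xs]) (auto simp: walk_def Suc_leI)
  then have "?P (vdist V E u v)"
    unfolding vdist_def by (rule LeastI)
  then obtain ys where "hd ys = u" "last ys = v" "length ys = Suc (vdist V E u v)"
    by blast
  moreover have "vdist V E u v \<noteq> 0"
  proof
    assume "vdist V E u v = 0"
    with calculation show False
      using assms(3) by (cases ys) auto
  qed
  ultimately show ?thesis
    by simp
qed

context
  fixes T :: "('a, 'v) gtree"
  assumes tree: "tree (verts T) (edges T)"
begin

interpretation tree "verts T" "edges T"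
  by (rule tree)

abbreviation dist_T :: "('v \<Rightarrow> real) \<Rightarrow> ('v \<Rightarrow> real) \<Rightarrow> real" where
  "dist_T \<equiv> tdist (verts T) (edges T)"

lemma edge_point_coords:
  assumes "{c, d} \<in> edges T" "p \<in> points T" "supp p \<subseteq> {c, d}"
  shows "p c + p d = 1"
proof -
  have "sum p (supp p) = sum p {c, d}"
    using assms(3) by (intro sum.mono_neutral_left) (auto simp: supp_def)
  then show ?thesis
    using assms(2) edgeD[OF assms(1)] by (simp add: in_points_iff)
qed

lemma edge_containing_edge:
  assumes "{c, d} \<in> edges T" "e \<in> edges T" "{c, d} \<subseteq> e"
  shows "e = {c, d}"
proof -
  obtain x y where "e = {x, y}"
    using assms(2) by (rule edgeE)
  then show ?thesis
    using assms(3) edgeD[OF assms(1)] by auto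
qed

lemma tdist_ends:
  assumes "{a, b} \<in> edges T"
  shows "dist_T (vpoint a) (vpoint b) = 1"
proof -
  have "\<exists>e\<in>edges T. supp (vpoint a) \<union> supp (vpoint b) \<subseteq> e"
    using assms by (intro bexI[of _ "{a, b}"]) auto
  then show ?thesis
    unfolding tdist_def by (subst if_P) (use edgeD[OF assms] in \<open>auto simp: vpoint_apply\<close>)
qed

text \<open>Together with \<open>tdist_vertex_near\<close> this recovers the position of a point on a segment of
  the core: a point whose distances from the two ends of an edge are at most 1 lies on this edge.\<close>

lemma tdist_vertex_far:
  assumes e: "{x, y} \<in> edges T" and z: "z \<in> points T" "supp z = {x, y}" and v: "v \<in> verts T" "v \<notin> supp z"
  shows "1 < dist_T (vpoint v) z" "1 < dist_T z (vpoint v)"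
proof -
  have far: "\<not> (\<exists>e\<in>edges T. supp (vpoint v) \<union> supp z \<subseteq> e)" "\<not> (\<exists>e\<in>edges T. supp z \<union> supp (vpoint v) \<subseteq> e)"
    using edge_containing_edge[OF e] z v by auto
  have "0 < z x" "0 < z y"
    using point_pos_iff[OF z(1)] z(2) by auto
  then have lt: "z x < 1" "z y < 1"
    using edge_point_coords[OF e z(1)] z(2) by auto
  have verts: "x \<in> verts T" "y \<in> verts T" "v \<noteq> x" "v \<noteq> y"
    using edgeD[OF e] v z by auto
  have vd: "1 \<le> vdist (verts T) (edges T) v x" "1 \<le> vdist (verts T) (edges T) v y"
      "1 \<le> vdist (verts T) (edges T) x v" "1 \<le> vdist (verts T) (edges T) y v"
    using vdist_pos verts v(1) by auto
  have vv: "vpoint v v = 1"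
    by (simp add: vpoint_apply)
  have "{(1 - vpoint v u) + real (vdist (verts T) (edges T) u w) + (1 - z w) | u w. u \<in> supp (vpoint v) \<and> w \<in> supp z}
      = {real (vdist (verts T) (edges T) v x) + (1 - z x), real (vdist (verts T) (edges T) v y) + (1 - z y)}"
    using z(2) vv by auto
  then show "1 < dist_T (vpoint v) z"
    unfolding tdist_def if_not_P[OF far(1)] using vd lt by simp
  have "{(1 - z u) + real (vdist (verts T) (edges T) u w) + (1 - vpoint v w) | u w. u \<in> supp z \<and> w \<in> supp (vpoint v)}
      = {(1 - z x) + real (vdist (verts T) (edges T) x v), (1 - z y) + real (vdist (verts T) (edges T) y v)}"
    using z(2) vv by auto
  then show "1 < dist_T z (vpoint v)"
    unfolding tdist_def if_not_P[OF far(2)] using vd lt by simp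
qed

lemma tdist_vertex_near:
  assumes e: "{x, y} \<in> edges T" and z: "z \<in> points T" "supp z = {x, y}"
  shows "dist_T (vpoint x) z = 1 - z x"
proof -
  have near: "\<exists>e\<in>edges T. supp (vpoint x) \<union> supp z \<subseteq> e"
    using e z by (intro bexI[of _ "{x, y}"]) auto
  have un: "supp (vpoint x) \<union> supp z = {x, y}"
    using z by auto
  have "z x + z y = 1"
    using edge_point_coords[OF e z(1)] z(2) by simp
  moreover have "0 \<le> z x" "0 \<le> z y"
    using z by (auto simp: in_points_iff)
  ultimately show ?thesis
    unfolding tdist_def if_P[OF near] unfolding un using edgeD[OF e] by (simp add: vpoint_apply)
qed

lemma infinite_open_edge:
  assumes e: "{c, d} \<in> edges T"
  shows "infinite (open_edge T {c, d})"
proof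
  assume fin: "finite (open_edge T {c, d})"
  have cd: "c \<in> verts T" "d \<in> verts T" "c \<noteq> d"
    using edgeD[OF e] by auto
  have "segment_point (vpoint c) d ` {0<..<1} \<subseteq> open_edge T {c, d}"
  proof (intro image_subsetI)
    fix t :: real assume "t \<in> {0<..<1}"
    then show "segment_point (vpoint c) d t \<in> open_edge T {c, d}"
      using segment_in_points[OF tree vpoint_in_points[OF cd(1)] cd(2), of t]
        supp_segment_point[OF tree vpoint_in_points[OF cd(1)], of t d] e
      by (auto simp: open_edge_def insert_commute)
  qed
  then have "finite (segment_point (vpoint c) d ` {0<..<1})"
    using fin by (rule finite_subset)
  moreover have "inj_on (segment_point (vpoint c) d) {0<..<1}"
  proof (rule inj_onI)
    fix s t assume "segment_point (vpoint c) d s = segment_point (vpoint c) d t"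
    then have "segment_point (vpoint c) d s d = segment_point (vpoint c) d t d"
      by simp
    then show "s = t"
      using cd by (simp add: segment_point_def vpoint_apply)
  qed
  ultimately have "finite {0<..<1::real}"
    by (rule finite_imageD)
  then show False
    by (simp add: infinite_Ioo)
qed

text \<open>Along an edge, the distance from \<open>y\<close> always agrees with one of finitely many functions
  of the first barycentric coordinate that are affine with slope 1 or -1, or is the absolute value
  of its difference from a constant.\<close>

lemma finite_distance_level:
  assumes e: "{c, d} \<in> edges T" and y: "y \<in> points T"
  shows "finite {w \<in> open_edge T {c, d}. dist_T y w = r}"
proof -
  let ?L = "{w \<in> open_edge T {c, d}. dist_T y w = r}"
  define far where "far u v = (1 - y u) + real (vdist (verts T) (edges T) u v) + 1 - r" for u v
  define F where "F = {y c - r, y c + r} \<union> (\<lambda>u. far u c) ` supp y \<union> (\<lambda>u. 1 - far u d) ` supp y"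
  note finy = finite_supp[OF tree y]
  have cd: "c \<noteq> d"
    using edgeD[OF e] by auto
  have coord: "w d = 1 - w c" and suppw: "supp w = {c, d}" if "w \<in> ?L" for w
    using that edge_point_coords[OF e, of w] by (auto simp: open_edge_def)
  have "(\<lambda>w. w c) ` ?L \<subseteq> F"
  proof (intro image_subsetI)
    fix w assume w: "w \<in> ?L"
    show "w c \<in> F"
    proof (cases "\<exists>e\<in>edges T. supp y \<union> supp w \<subseteq> e")
      case True
      then have sub: "supp y \<subseteq> {c, d}"
        using edge_containing_edge[OF e] suppw[OF w] by blast
      then have un: "supp y \<union> supp w = {c, d}"
        using suppw[OF w] by blast
      have "r = (\<Sum>v\<in>supp y \<union> supp w. \<bar>y v - w v\<bar>) / 2"
        using w True by (simp add: tdist_def)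
      also have "\<dots> = (\<bar>y c - w c\<bar> + \<bar>y d - w d\<bar>) / 2"
        using cd by (simp add: un)
      also have "\<dots> = \<bar>y c - w c\<bar>"
      proof -
        have "y d - w d = - (y c - w c)"
          using edge_point_coords[OF e y sub] coord[OF w] by linarith
        then show ?thesis
          by simp
      qed
      finally show ?thesis
        by (auto simp: F_def)
    next
      case False
      let ?M = "{(1 - y u) + real (vdist (verts T) (edges T) u v) + (1 - w v) | u v. u \<in> supp y \<and> v \<in> supp w}"
      have M: "?M = (\<lambda>(u, v). (1 - y u) + real (vdist (verts T) (edges T) u v) + (1 - w v)) ` (supp y \<times> {c, d})"
        using suppw[OF w] by auto
      have "finite ?M" "?M \<noteq> {}"
        unfolding M using finy supp_nonempty[OF y] by auto
      then have "Min ?M \<in> ?M"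
        by (rule Min_in)
      moreover have "r = Min ?M"
      proof -
        have "r = dist_T y w"
          using w by simp
        also have "\<dots> = Min ?M"
          unfolding tdist_def if_not_P[OF False] ..
        finally show ?thesis .
      qed
      ultimately obtain u v where "u \<in> supp y" "v \<in> {c, d}"
          "r = (1 - y u) + real (vdist (verts T) (edges T) u v) + (1 - w v)"
        unfolding M by auto
      then have "u \<in> supp y" "w c = far u c \<or> w c = 1 - far u d"
        using coord[OF w] by (auto simp: far_def)
      then show ?thesis
        by (auto simp: F_def)
    qed
  qed
  moreover have "finite F"
    using finy by (simp add: F_def)
  ultimately have "finite ((\<lambda>w. w c) ` ?L)"
    by (rule finite_subset)
  moreover have "inj_on (\<lambda>w. w c) ?L"
  proof (rule inj_onI)
    fix w w' assume ww: "w \<in> ?L" "w' \<in> ?L" "w c = w' c"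
    show "w = w'"
    proof
      fix x
      show "w x = w' x"
        using ww coord[OF ww(1)] coord[OF ww(2)] suppw[OF ww(1)] suppw[OF ww(2)]
          not_in_supp[of x w] not_in_supp[of x w'] by (cases "x \<in> {c, d}") auto
    qed
  qed
  ultimately show ?thesis
    by (rule finite_imageD)
qed

end

section \<open>The two-cells of the core\<close>

text \<open>Over the midpoint of \<open>{a, b}\<close> there are only the segments attached to this edge, and
  they are met at time \<open>1/2\<close>.\<close>

lemma (in splitting_pair) prod_segment_over_midpoint:
  assumes e: "{a, b} \<in> edges T1" and e': "{a', b'} \<in> edges T1"
    and z: "z \<in> points T1" "supp z = {a, b}" "z a = 1 / 2"
    and mem: "(z, w) \<in> prod_segment T1 T2 (vpoint a', y) (vpoint b', y')"
  shows "{a', b'} = {a, b}" "dist_T T2 y w = 1 / 2 * dist_T T2 y y'"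
proof -
  obtain t where t: "0 \<le> t" "t \<le> 1" "dist_T T1 (vpoint a') z = t * dist_T T1 (vpoint a') (vpoint b')"
      "dist_T T1 z (vpoint b') = (1 - t) * dist_T T1 (vpoint a') (vpoint b')"
      "dist_T T2 y w = t * dist_T T2 y y'"
    using mem by (auto simp: prod_segment_def Let_def)
  then have d: "dist_T T1 (vpoint a') z = t" "dist_T T1 z (vpoint b') = 1 - t"
    using tdist_ends[OF t1.tree_axioms e'] by simp_all
  note far = tdist_vertex_far[OF t1.tree_axioms e z(1,2)]
  have "a' \<in> supp z"
    using far(1)[OF t1.edgeD(1)[OF e']] d t by fastforce
  moreover have "b' \<in> supp z"
    using far(2)[OF t1.edgeD(2)[OF e']] d t by fastforce
  ultimately show eq: "{a', b'} = {a, b}"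
    using z(2) t1.edgeD(3)[OF e'] by auto
  have "z a' = 1 / 2"
    using edge_point_coords[OF t1.tree_axioms e z(1)] z eq by (auto simp: doubleton_eq_iff)
  then have "t = 1 / 2"
    using tdist_vertex_near[OF t1.tree_axioms e' z(1)] z(2) eq d(1) by simp
  then show "dist_T T2 y w = 1 / 2 * dist_T T2 y y'"
    using t(5) by simp
qed

text \<open>Non-trivial stabilizers have no fixed point, so the two kinds of cells over an edge exclude each
  other. If the stabilizer has a fixed point, the ends of the edge are joined by segments in both
  orders; the points of these segments over the midpoint are finitely many on each edge of the
  second tree.\<close>

lemma (in splitting_pair) two_cells_core:
  assumes dich: "\<And>e. e \<in> edges T1 \<Longrightarrow>
      acts_nontrivially G T2 (edge_stab G T1 e) \<or> has_fixed_point G T2 (edge_stab G T1 e)"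
    and choices: "core_choices G T1 T2 c f"
  shows "two_cells T1 T2 (asymmetric_core G T1 T2 c f) =
    {(e1, e2). e1 \<in> edges T1 \<and> e2 \<in> Min_edges G T2 (edge_stab G T1 e1)}"
proof (intro equalityI subsetI)
  fix \<epsilon> assume "\<epsilon> \<in> {(e1, e2). e1 \<in> edges T1 \<and> e2 \<in> Min_edges G T2 (edge_stab G T1 e1)}"
  then obtain e1 e2 where \<epsilon>: "\<epsilon> = (e1, e2)" "e1 \<in> edges T1" "e2 \<in> Min_edges G T2 (edge_stab G T1 e1)"
    by blast
  then have nt: "acts_nontrivially G T2 (edge_stab G T1 e1)"
    and e2: "e2 \<in> sub_edges T2 (Min_tree T2 (edge_stab G T1 e1))"
    by (auto simp: Min_edges_def split: if_splits)
  have "open_edge T2 e2 \<subseteq> Min_points T2 (edge_stab G T1 e1)"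
    using e2 by (auto simp: open_edge_def Min_points_def realization_def in_points_iff)
  then have "open_edge T1 e1 \<times> open_edge T2 e2 \<subseteq> asymmetric_core G T1 T2 c f"
    using nt \<epsilon>(2) unfolding asymmetric_core_def by blast
  then show "\<epsilon> \<in> two_cells T1 T2 (asymmetric_core G T1 T2 c f)"
    using \<epsilon> e2 by (simp add: two_cells_def sub_edges_def)
next
  fix \<epsilon> assume "\<epsilon> \<in> two_cells T1 T2 (asymmetric_core G T1 T2 c f)"
  then obtain e1 e2 where \<epsilon>: "\<epsilon> = (e1, e2)" "e1 \<in> edges T1" "e2 \<in> edges T2"
    and sub: "open_edge T1 e1 \<times> open_edge T2 e2 \<subseteq> asymmetric_core G T1 T2 c f"
    by (auto simp: two_cells_def)
  let ?K = "edge_stab G T1 e1"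
  obtain a b where ab: "e1 = {a, b}" "a \<noteq> b" "a \<in> verts T1" "b \<in> verts T1"
    using t1.edgeE[OF \<epsilon>(2)] by metis
  obtain x y where xy: "e2 = {x, y}" "x \<noteq> y"
    using t2.edgeE[OF \<epsilon>(3)] by metis
  define z where "z = segment_point (vpoint a) b (1/2)"
  note vpa = vpoint_in_points[OF ab(3)]
  have supp_z: "supp z = {a, b}"
    using supp_segment_point[OF t1.tree_axioms vpa, of "1/2" b] by (simp add: z_def insert_commute)
  have adj: "insert b (supp (vpoint a)) \<in> edges T1"
    using \<epsilon>(2) ab(1) by (simp add: insert_commute)
  have "z \<in> points T1"
    unfolding z_def by (rule segment_in_points[OF t1.tree_axioms vpa ab(4) disjI1[OF adj]]) simp_all
  moreover have "z a = 1 / 2"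
    using ab(2) by (simp add: z_def segment_point_def vpoint_apply)
  ultimately have z: "z \<in> points T1" "supp z = {a, b}" "z a = 1 / 2"
    using supp_z by blast+
  \<comment> \<open>the part of the core over the midpoint of \<open>e1\<close>\<close>
  have over_z: "acts_nontrivially G T2 ?K \<and> w \<in> Min_points T2 ?K \<or>
      has_fixed_point G T2 ?K \<and> (dist_T T2 (f e1 a) w = 1 / 2 * dist_T T2 (f e1 a) (f e1 b) \<or>
        dist_T T2 (f e1 b) w = 1 / 2 * dist_T T2 (f e1 b) (f e1 a))"
    if w: "w \<in> open_edge T2 e2" for w
  proof -
    have "(z, w) \<in> asymmetric_core G T1 T2 c f"
      using sub w z ab(1) by (auto simp: open_edge_def)
    then consider (vertex) v where "z = vpoint v"
      | (edge) e where "acts_nontrivially G T2 (edge_stab G T1 e)" "z \<in> open_edge T1 e"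
          "w \<in> Min_points T2 (edge_stab G T1 e)"
      | (seg) a' b' where "{a', b'} \<in> edges T1" "has_fixed_point G T2 (edge_stab G T1 {a', b'})"
          "(z, w) \<in> prod_segment T1 T2 (vpoint a', f {a', b'} a') (vpoint b', f {a', b'} b')"
      unfolding asymmetric_core_def by blast
    then show ?thesis
    proof cases
      case vertex
      then show ?thesis
        using z(2) ab(2) by auto
    next
      case edge
      then have "e = e1"
        using z(2) ab(1) by (simp add: open_edge_def)
      then show ?thesis
        using edge by blast
    next
      case seg
      note eq = prod_segment_over_midpoint[OF \<epsilon>(2)[unfolded ab(1)] seg(1) z seg(3)]
      have "a' = a \<and> b' = b \<or> a' = b \<and> b' = a"
        using eq(1) by (auto simp: doubleton_eq_iff)
      then show ?thesis
        using eq seg(2) ab(1) by (auto simp: insert_commute)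
    qed
  qed
  show "\<epsilon> \<in> {(e1, e2). e1 \<in> edges T1 \<and> e2 \<in> Min_edges G T2 (edge_stab G T1 e1)}"
  proof (cases "acts_nontrivially G T2 ?K")
    case True
    then have "\<not> has_fixed_point G T2 ?K"
      by (auto simp: acts_nontrivially_def has_fixed_point_def fixed_by_def elliptic_def)
    moreover obtain w where w: "w \<in> open_edge T2 e2"
      using infinite_open_edge[OF t2.tree_axioms \<epsilon>(3)[unfolded xy(1)]] xy(1)
      by (metis ex_in_conv finite.emptyI)
    ultimately have "w \<in> Min_points T2 ?K"
      using over_z by blast
    then have "e2 \<in> sub_edges T2 (Min_tree T2 ?K)"
      using w xy by (auto simp: Min_points_def realization_def open_edge_def)
    then show ?thesis
      using \<epsilon> True by (simp add: Min_edges_def)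
  next
    case False
    then have "has_fixed_point G T2 ?K"
      using dich \<epsilon>(2) by blast
    then have fp: "f e1 a \<in> points T2" "f e1 b \<in> points T2"
      using choices \<epsilon>(2) ab(1) by (auto simp: core_choices_def fixed_by_def)
    have "open_edge T2 e2 \<subseteq>
        {w \<in> open_edge T2 {x, y}. dist_T T2 (f e1 a) w = 1 / 2 * dist_T T2 (f e1 a) (f e1 b)} \<union>
        {w \<in> open_edge T2 {x, y}. dist_T T2 (f e1 b) w = 1 / 2 * dist_T T2 (f e1 b) (f e1 a)}"
      using over_z False xy(1) by blast
    then have "finite (open_edge T2 e2)"
      by (rule finite_subset)
        (intro finite_UnI finite_distance_level[OF t2.tree_axioms \<epsilon>(3)[unfolded xy(1)]] fp)
    then show ?thesis
      using infinite_open_edge[OF t2.tree_axioms \<epsilon>(3)[unfolded xy(1)]] xy(1) by simp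
  qed
qed

section \<open>Counting orbits\<close>

lemma ecard_bij_betw: "bij_betw h A B \<Longrightarrow> ecard A = ecard B"
  using bij_betw_finite bij_betw_same_card by (fastforce simp: ecard_def)

context splitting_pair
begin

lemma strongly_crossing_pairs_eq:
  assumes dich: "\<And>e. e \<in> edges T1 \<Longrightarrow>
      acts_nontrivially G T2 (edge_stab G T1 e) \<or> has_fixed_point G T2 (edge_stab G T1 e)"
    and p1: "p1 \<in> points T1" and p2: "p2 \<in> points T2"
    and S: "finite S" "S \<subseteq> carrier G" "generate G S = carrier G"
  shows "strongly_crossing_pairs G S T1 p1 T2 p2 =
    {(e1, e2). e1 \<in> edges T1 \<and> e2 \<in> Min_edges G T2 (edge_stab G T1 e1)}"
proof (intro equalityI subsetI)
  fix \<epsilon> assume "\<epsilon> \<in> strongly_crossing_pairs G S T1 p1 T2 p2"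
  then obtain a b c d where "\<epsilon> = ({a, b}, {c, d})" "{a, b} \<in> edges T1" "{c, d} \<in> edges T2"
      "crosses_strongly G S (half_set G T1 p1 (a, b)) (edge_stab G T2 {c, d}) (half_set G T2 p2 (c, d))"
    by (auto simp: strongly_crossing_pairs_def)
  then show "\<epsilon> \<in> {(e1, e2). e1 \<in> edges T1 \<and> e2 \<in> Min_edges G T2 (edge_stab G T1 e1)}"
    using crosses_strongly_iff[OF _ _ p1 p2 S dich] by simp
next
  fix \<epsilon> assume "\<epsilon> \<in> {(e1, e2). e1 \<in> edges T1 \<and> e2 \<in> Min_edges G T2 (edge_stab G T1 e1)}"
  then obtain e1 e2 where \<epsilon>: "\<epsilon> = (e1, e2)" "e1 \<in> edges T1" "e2 \<in> Min_edges G T2 (edge_stab G T1 e1)"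
    by blast
  have e2: "e2 \<in> edges T2"
    using \<epsilon>(3) by (auto simp: Min_edges_def sub_edges_def split: if_splits)
  obtain a b where ab: "e1 = {a, b}"
    using t1.edgeE[OF \<epsilon>(2)] by metis
  obtain c d where cd: "e2 = {c, d}"
    using t2.edgeE[OF e2] by metis
  have "crosses_strongly G S (half_set G T1 p1 (a, b)) (edge_stab G T2 {c, d}) (half_set G T2 p2 (c, d))"
    using crosses_strongly_iff[OF _ _ p1 p2 S dich] \<epsilon> e2 ab cd by simp
  then show "\<epsilon> \<in> strongly_crossing_pairs G S T1 p1 T2 p2"
    using \<epsilon> e2 ab cd unfolding strongly_crossing_pairs_def by blast
qed

text \<open>Every orbit of pairs meets the fiber over \<open>e1\<close>, in a single orbit of the stabilizer of
  \<open>e1\<close>.\<close>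

lemma ecard_orbits_fiber:
  assumes P: "P \<subseteq> edges T1 \<times> edges T2"
    and inv: "\<And>g \<epsilon>. g \<in> carrier G \<Longrightarrow> \<epsilon> \<in> P \<Longrightarrow> edge_pair_act T1 T2 g \<epsilon> \<in> P"
    and e1: "e1 \<in> edges T1"
  shows "ecard (orbits G P (edge_pair_act T1 T2)) =
    ecard (orbits (G\<lparr>carrier := edge_stab G T1 e1\<rparr>) {e2. (e1, e2) \<in> P} (edge_act T2))"
proof (rule ecard_bij_betw)
  let ?act = "edge_pair_act T1 T2"
  let ?K = "edge_stab G T1 e1"
  let ?fiber = "\<lambda>Z. {e2. (e1, e2) \<in> Z}"
  have mult: "?act (g \<otimes> h) \<epsilon> = ?act g (?act h \<epsilon>)" if "\<epsilon> \<in> P" "g \<in> carrier G" "h \<in> carrier G" for g h \<epsilon>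
    using that P t1.edge_act_mult t2.edge_act_mult by (fastforce simp: edge_pair_act_def)
  have inverse: "?act (inv g) (?act g \<epsilon>) = \<epsilon>" if "\<epsilon> \<in> P" "g \<in> carrier G" for g \<epsilon>
    using that P t1.edge_act_inv_act t2.edge_act_inv_act by (fastforce simp: edge_pair_act_def)
  have orbit_eq: "orbit G ?act (?act g \<epsilon>) = orbit G ?act \<epsilon>" if "\<epsilon> \<in> P" "g \<in> carrier G" for g \<epsilon>
  proof
    show "orbit G ?act (?act g \<epsilon>) \<subseteq> orbit G ?act \<epsilon>"
    proof
      fix \<eta> assume "\<eta> \<in> orbit G ?act (?act g \<epsilon>)"
      then obtain k where k: "k \<in> carrier G" "\<eta> = ?act k (?act g \<epsilon>)"
        by (auto simp: orbit_def)
      then have "\<eta> = ?act (k \<otimes> g) \<epsilon>"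
        using mult[OF that(1) k(1) that(2)] by simp
      then show "\<eta> \<in> orbit G ?act \<epsilon>"
        using k(1) that(2) by (auto simp: orbit_def)
    qed
    show "orbit G ?act \<epsilon> \<subseteq> orbit G ?act (?act g \<epsilon>)"
    proof
      fix \<eta> assume "\<eta> \<in> orbit G ?act \<epsilon>"
      then obtain k where k: "k \<in> carrier G" "\<eta> = ?act k \<epsilon>"
        by (auto simp: orbit_def)
      then have "\<eta> = ?act (k \<otimes> inv g) (?act g \<epsilon>)"
        using mult[OF inv[OF that(2,1)], of k "inv g"] inverse[OF that] that(2) by simp
      then show "\<eta> \<in> orbit G ?act (?act g \<epsilon>)"
        using k(1) that(2) by (auto simp: orbit_def)
    qed
  qed
  have fiber: "?fiber (orbit G ?act (e1, e2)) = orbit (G\<lparr>carrier := ?K\<rparr>) (edge_act T2) e2" for e2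
    by (auto simp: orbit_def edge_pair_act_def t1.edge_stab_iff)
  have normal_form: "\<exists>e2. (e1, e2) \<in> P \<and> Z = orbit G ?act (e1, e2)" if "Z \<in> orbits G P ?act" for Z
  proof -
    obtain e e2 where e: "(e, e2) \<in> P" "Z = orbit G ?act (e, e2)"
      using \<open>Z \<in> orbits G P ?act\<close> by (auto simp: orbits_def)
    then obtain g where g: "g \<in> carrier G" "edge_act T1 g e = e1"
      using t1.edges_transitive e1 P by blast
    then have "?act g (e, e2) = (e1, edge_act T2 g e2)"
      by (simp add: edge_pair_act_def)
    then show ?thesis
      using orbit_eq[OF e(1) g(1)] inv[OF g(1) e(1)] e(2) by metis
  qed
  show "bij_betw ?fiber (orbits G P ?act) (orbits (G\<lparr>carrier := ?K\<rparr>) {e2. (e1, e2) \<in> P} (edge_act T2))"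
  proof (rule bij_betw_imageI)
    show "inj_on ?fiber (orbits G P ?act)"
    proof (rule inj_onI)
      fix Z Z' assume Z: "Z \<in> orbits G P ?act" "Z' \<in> orbits G P ?act" "?fiber Z = ?fiber Z'"
      obtain e2 where e2: "(e1, e2) \<in> P" "Z = orbit G ?act (e1, e2)"
        using normal_form[OF Z(1)] by blast
      obtain e2' where e2': "(e1, e2') \<in> P" "Z' = orbit G ?act (e1, e2')"
        using normal_form[OF Z(2)] by blast
      have "?act \<one> (e1, e2) = (e1, e2)"
        using e2(1) P t1.edge_act_one t2.edge_act_one by (auto simp: edge_pair_act_def)
      then have "(e1, e2) \<in> Z"
        unfolding e2(2) orbit_def by (metis (mono_tags, lifting) mem_Collect_eq t1.one_closed)
      then have "(e1, e2) \<in> Z'"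
        using Z(3) by blast
      then obtain g where "g \<in> carrier G" "(e1, e2) = ?act g (e1, e2')"
        unfolding e2'(2) orbit_def by blast
      then show "Z = Z'"
        using orbit_eq[OF e2'(1)] e2(2) e2'(2) by metis
    qed
    show "?fiber ` orbits G P ?act = orbits (G\<lparr>carrier := ?K\<rparr>) {e2. (e1, e2) \<in> P} (edge_act T2)"
    proof
      show "?fiber ` orbits G P ?act \<subseteq> orbits (G\<lparr>carrier := ?K\<rparr>) {e2. (e1, e2) \<in> P} (edge_act T2)"
      proof (intro image_subsetI)
        fix Z assume "Z \<in> orbits G P ?act"
        then obtain e2 where "(e1, e2) \<in> P" "Z = orbit G ?act (e1, e2)"
          using normal_form by blast
        then show "?fiber Z \<in> orbits (G\<lparr>carrier := ?K\<rparr>) {e2. (e1, e2) \<in> P} (edge_act T2)"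
          using fiber unfolding orbits_def by blast
      qed
      show "orbits (G\<lparr>carrier := ?K\<rparr>) {e2. (e1, e2) \<in> P} (edge_act T2) \<subseteq> ?fiber ` orbits G P ?act"
        unfolding orbits_def fiber[symmetric] by blast
    qed
  qed
qed

lemma Min_edges_equivariant:
  assumes g: "g \<in> carrier G" and e1: "e1 \<in> edges T1" and e2: "e2 \<in> Min_edges G T2 (edge_stab G T1 e1)"
  shows "edge_act T2 g e2 \<in> Min_edges G T2 (edge_stab G T1 (edge_act T1 g e1))"
  using assms t2.edge_act_axis_edges[OF g _ t1.edge_stab_conj[OF g e1]]
    t2.Min_edges_eq[OF t1.subgroup_edge_stab] t1.edge_act_closed[OF g e1] by simp

end

lemma one_edge_splitting_action:
  assumes "one_edge_splitting_tree G T"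
  shows "splitting_action G T"
proof -
  interpret tree_action G T
    using assms by (simp add: one_edge_splitting_tree_def tree_action_def tree_action_axioms_def tree_def)
  show ?thesis
  proof
    show "edges T \<noteq> {}" "e \<in> edges T \<Longrightarrow> e' \<in> edges T \<Longrightarrow> \<exists>g\<in>carrier G. edge_act T g e = e'" for e e'
      using assms by (auto simp: one_edge_splitting_tree_def)
    fix v assume v: "v \<in> verts T"
    have "\<not> (\<exists>p\<in>points T. \<forall>g\<in>carrier G. pt_act G T g p = p)"
      using assms by (simp add: one_edge_splitting_tree_def)
    then obtain g where "g \<in> carrier G" "pt_act G T g (vpoint v) \<noteq> vpoint v"
      using vpoint_in_points[OF v] by blast
    then show "\<exists>g\<in>carrier G. act T g v \<noteq> v"
      using pt_act_vpoint[OF _ v] by metis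
  qed
qed

theorem corollary11p4:
  fixes G :: "('a, 'b) monoid_scheme"
    and T1 :: "('a, 'v) gtree" and T2 :: "('a, 'w) gtree"
    and S :: "'a set"
    and p1 :: "'v \<Rightarrow> real" and p2 :: "'w \<Rightarrow> real"
    and c :: "'v \<Rightarrow> 'w \<Rightarrow> real" and f :: "'v set \<Rightarrow> 'v \<Rightarrow> 'w \<Rightarrow> real"
  assumes "group G"
    and "finite S" and "S \<subseteq> carrier G" and "generate G S = carrier G"
    and "one_edge_splitting_tree G T1" and "one_edge_splitting_tree G T2"
    and "\<forall>v\<in>verts T1. acts_nontrivially G T2 (vertex_stab G T1 v) \<or>
                       has_fixed_point G T2 (vertex_stab G T1 v)"
    and "\<forall>e\<in>edges T1. acts_nontrivially G T2 (edge_stab G T1 e) \<or>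
                       has_fixed_point G T2 (edge_stab G T1 e)"
    and "p1 \<in> points T1" and "p2 \<in> points T2"
    and "core_choices G T1 T2 c f"
  shows "strong_intersection_number G S T1 p1 T2 p2 =
           ecard (orbits G (two_cells T1 T2 (asymmetric_core G T1 T2 c f)) (edge_pair_act T1 T2)) \<and>
         (\<forall>e1\<in>edges T1. strong_intersection_number G S T1 p1 T2 p2 =
           ecard (orbits (G\<lparr>carrier := edge_stab G T1 e1\<rparr>)
                    (Min_edges G T2 (edge_stab G T1 e1)) (edge_act T2)))"
proof -
  interpret splitting_pair G T1 T2
    unfolding splitting_pair_def using assms(5,6) by (blast intro: one_edge_splitting_action)
  define P where "P = {(e1, e2). e1 \<in> edges T1 \<and> e2 \<in> Min_edges G T2 (edge_stab G T1 e1)}"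
  note dich = bspec[OF assms(8)]
  have crossing: "strongly_crossing_pairs G S T1 p1 T2 p2 = P"
    unfolding P_def by (rule strongly_crossing_pairs_eq[OF dich assms(9,10,2,3,4)])
  have cells: "two_cells T1 T2 (asymmetric_core G T1 T2 c f) = P"
    unfolding P_def by (rule two_cells_core[OF dich assms(11)])
  have P: "P \<subseteq> edges T1 \<times> edges T2"
    by (auto simp: P_def Min_edges_def sub_edges_def split: if_splits)
  have inv: "edge_pair_act T1 T2 g \<epsilon> \<in> P" if "g \<in> carrier G" "\<epsilon> \<in> P" for g \<epsilon>
    using that Min_edges_equivariant t1.edge_act_closed by (auto simp: P_def edge_pair_act_def)
  have fiber: "{e2. (e1, e2) \<in> P} = Min_edges G T2 (edge_stab G T1 e1)" if "e1 \<in> edges T1" for e1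
    using that by (simp add: P_def)
  show ?thesis
    unfolding strong_intersection_number_def crossing cells
    using ecard_orbits_fiber[OF P inv] fiber by simp
qed

end
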